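(* For every $\lambda\in(0,1]$, $$\lim_{n\to\infty}\mathrm{APX}(n,\lambda)=\frac{1}{\sup_{0\le c\le1}g_\lambda(c)}=\begin{cases}\dfrac{\Gamma(2-\lambda)\,(\lambda+\eta(\lambda))}{\eta(\lambda)^{1-\lambda}},&0<\lambda\le\lambda^\ast,\\[3mm] \dfrac{1}{1-e^{-\Gamma(2-\lambda)^{-1/\lambda}}},&\lambda^\ast\le\lambda\le1,\end{cases}$$ where $g_\lambda(c)=c\left(1-e^{-(c\,\Gamma(2-\lambda))^{-1/\lambda}}\right)$ for $c>0$ and $g_\lambda(0)=0$; $\lambda^\ast\approx0.4940$ is the unique root in $(0,1]$ of $$1-\left(1+\frac{\Gamma(2-\lambda)^{-1/\lambda}}{\lambda}\right)e^{-\Gamma(2-\lambda)^{-1/\lambda}}=0;$$ and, for $\lambda\in(0,1)$, $\eta(\lambda)$ is the unique positive solution $x$ of $e^x=1+\frac{x}{\lambda}$.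
   Context: $F$ denotes the cdf of a continuous (absolutely continuous) probability distribution with pdf $f$, supported on an interval $D_F\subseteq[0,\infty)$. For $\lambda\in(0,1]$, $F$ is $\lambda$-regular if $\phi_\lambda(x)=\lambda x-\frac{1-F(x)}{f(x)}$ is nondecreasing on $D_F$; equivalently $(1-F(x))^{-\lambda}$ is convex. $\mathcal D_\lambda$ is the family of all $\lambda$-regular distributions. For $n\ge2$ bidders with i.i.d. valuations from $F$, let $X_{1:n}\le\dots\le X_{n:n}$ be the order statistics of $n$ i.i.d. draws. $\mathrm{Myerson}(F,n)$ denotes the maximum expected revenue achievable by any (truthful) auction; by Myerson's theorem, for these distributions it equals the best expected revenue of a second-price auction with reserve, $\mathrm{Myerson}(F,n)=\sup_{p\ge0}\mathbb{E}\left[\max\{p,X_{n-1:n}\}\mathbf 1\{X_{n:n}\ge p\}\right]$. The optimal anonymous pricing revenue is $\mathrm{Price}(F,n)=\sup_{p\in D_F}p\,(1-F(p)^n)$; $\mathrm{APX}(n,\lambda)=\sup_{F\in\mathcal D_\lambda}\mathrm{Myerson}(F,n)/\mathrm{Price}(F,n)$. $\Gamma$ is the gamma function. *)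

theory Defs
  imports "HOL-Probability.Probability"
begin

(* M is the absolutely continuous law with pdf f supported on the interval D.
   The pdf is positive on D so that (1 - F) / f is a genuine quotient there; D need not be
   closed, so a pdf vanishing at an endpoint of the support is covered by omitting that
   endpoint from D. *)
definition supported_pdf :: "real measure \<Rightarrow> (real \<Rightarrow> real) \<Rightarrow> real set \<Rightarrow> bool" where
  "supported_pdf M f D \<longleftrightarrow>
     is_interval D \<and> D \<subseteq> {0..} \<and>
     f \<in> borel_measurable borel \<and>
     (\<forall>x\<in>D. f x > 0) \<and> (\<forall>x. x \<notin> D \<longrightarrow> f x = 0) \<and>
     M = density lborel (\<lambda>x. ennreal (f x)) \<and> prob_space M"

definition virtual_value :: "real \<Rightarrow> real measure \<Rightarrow> (real \<Rightarrow> real) \<Rightarrow> real \<Rightarrow> real" where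
  "virtual_value lam M f x = lam * x - (1 - cdf M x) / f x"

(* A distribution is kept together with its supporting interval, over which prices range. *)
definition regular_dists :: "real \<Rightarrow> (real measure \<times> real set) set" where
  "regular_dists lam =
     {(M, D). \<exists>f. supported_pdf M f D \<and> mono_on D (virtual_value lam M f)}"

definition profiles :: "nat \<Rightarrow> (nat \<Rightarrow> real) set" where
  "profiles n = PiE {..<n} (\<lambda>_. {0..})"

(* Single-item direct mechanisms for bidders 0, ..., n - 1: on the bid profile v, bidder i wins
   with probability x v i and pays p v i (in expectation over the mechanism's own randomness).
   The last two conjuncts are ex-post individual rationality and dominant-strategy incentive
   compatibility. Payments may be negative. *)
definition truthful_auction ::
  "nat \<Rightarrow> ((nat \<Rightarrow> real) \<Rightarrow> nat \<Rightarrow> real) \<Rightarrow> ((nat \<Rightarrow> real) \<Rightarrow> nat \<Rightarrow> real) \<Rightarrow> bool" where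
  "truthful_auction n x p \<longleftrightarrow>
     (\<forall>i<n. (\<lambda>v. x v i) \<in> borel_measurable (PiM {..<n} (\<lambda>_. borel)) \<and>
            (\<lambda>v. p v i) \<in> borel_measurable (PiM {..<n} (\<lambda>_. borel))) \<and>
     (\<forall>v\<in>profiles n. (\<forall>i<n. 0 \<le> x v i) \<and> (\<Sum>i<n. x v i) \<le> 1) \<and>
     (\<forall>v\<in>profiles n. \<forall>i<n. 0 \<le> v i * x v i - p v i) \<and>
     (\<forall>v\<in>profiles n. \<forall>i<n. \<forall>b\<ge>0.
        v i * x (v(i := b)) i - p (v(i := b)) i \<le> v i * x v i - p v i)"

(* Optimal expected revenue for n bidders with values drawn i.i.d. from M. Only auctions whose
   revenue is integrable compete. For the regular distributions considered here the positive
   part of the revenue is always integrable, so this only discards auctions with expected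
   revenue minus infinity. *)
definition Myerson :: "real measure \<Rightarrow> nat \<Rightarrow> ereal" where
  "Myerson M n =
     (SUP (x, p) \<in> {(x, p). truthful_auction n x p \<and>
                       integrable (PiM {..<n} (\<lambda>_. M)) (\<lambda>v. \<Sum>i<n. p v i)}.
        ereal (\<integral>v. (\<Sum>i<n. p v i) \<partial>(PiM {..<n} (\<lambda>_. M))))"

definition Price :: "real measure \<times> real set \<Rightarrow> nat \<Rightarrow> ereal" where
  "Price MD n = (SUP q \<in> snd MD. ereal (q * (1 - cdf (fst MD) q ^ n)))"

definition APX :: "nat \<Rightarrow> real \<Rightarrow> ereal" where
  "APX n lam = (SUP MD \<in> regular_dists lam. Myerson (fst MD) n / Price MD n)"

definition g :: "real \<Rightarrow> real \<Rightarrow> real" where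
  "g lam c = (if c = 0 then 0 else c * (1 - exp (- ((c * Gamma (2 - lam)) powr (- 1 / lam)))))"

definition is_lambda_star :: "real \<Rightarrow> bool" where
  "is_lambda_star l \<longleftrightarrow> 0 < l \<and> l \<le> 1 \<and>
     1 - (1 + Gamma (2 - l) powr (- 1 / l) / l) * exp (- (Gamma (2 - l) powr (- 1 / l))) = 0"

definition lambda_star :: real where
  "lambda_star = (THE l. is_lambda_star l)"

definition is_eta :: "real \<Rightarrow> real \<Rightarrow> bool" where
  "is_eta lam x \<longleftrightarrow> 0 < x \<and> exp x = 1 + x / lam"

definition eta :: "real \<Rightarrow> real" where
  "eta lam = (THE x. is_eta lam x)"

end

theory Submission
  imports Defs
begin

text \<open>
  In the quantile scale $s = (1 - F)^{-\lambda}$, regularity makes the value a concave function of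
  \<open>s\<close>. It therefore lies below a line $\alpha s + \beta$ touching it at any chosen
  point, and $\beta \ge -\alpha$ because values are nonnegative at $s = 1$. Truthful payments
  are mixtures of posted prices, so the optimal revenue is at most that of the linear value function,
  $\alpha \Gamma_n + \max(\beta, 0)$ with $\Gamma_n \sim \Gamma(2-\lambda)\, n^\lambda$. If the
  line touches at $s = c\,\Gamma_n$ with $c \le 1$, then this is at most $1/c + o(1)$ times the value
  \<open>x\<close> at the touching point, while the anonymous price \<open>x\<close> earns at least
  $x (1 - e^{-(c \Gamma(2-\lambda))^{-1/\lambda}} - o(1))$; hence the upper bound $1/g_\lambda(c)$.

  Conversely, with $s = t^{-\lambda}$, the function $1/(1 - e^{-t})$ is convex in \<open>s\<close>. Its tangent
  at the point corresponding to the maximiser of $g_\lambda$ on $[0,1]$ has a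
  nonnegative intercept \<open>b\<close>, and if it is $a s + b$, then valuations $a (n U)^{-\lambda} + b$ with \<open>U\<close> uniform are regular, no anonymous
  price earns more than $1 + o(1)$, and the second-price auction earns
  $a\,\Gamma(2-\lambda) + b + o(1) = 1 / \sup g_\lambda + o(1)$.

  Uniqueness of $\lambda^\ast$ reduces to the monotonicity of
  $\lambda\, t^{-1} (e^t - 1)$ along $t = \Gamma(2-\lambda)^{-1/\lambda}$, which follows from that of
  $\lambda t$ because $(e^t - 1)/t^2$ decreases on the range of \<open>t\<close>; the
  monotonicity of $\lambda t$ rests on $1 + \psi(1) = \psi(2)$ for the digamma function $\psi$.
\<close>

subsection \<open>The critical regularity parameter\<close>

text \<open>The two bounds meet by complementary slackness between c <= 1 and b >= 0. At an interior
  maximiser of s (1 - e^(-t)), with s = t^(-lam), the tangent to 1 / (1 - e^(-t)) passes through the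
  origin, so b = 0; a maximiser at c = 1 sits at s = Gamma(2 - lam), so that a Gamma(2 - lam) + b is
  the height of the curve itself. Hence eta and lambda_star solve the same equation lam (e^t - 1) /
  t = 1, once for t and once along t = Gamma(2 - lam)^(-1/lam); the quotient defined here is shared
  by both. Two obstacles shape the upper bound. A regular density need not be continuous, so
  derivatives of the tail are replaced by integral inequalities and Euler steps. And at lam = 1 the
  linear value function has an infinite expected maximum although its optimal revenue is finite, so
  revenue is bounded through posted prices, and the part earned at vanishing quantiles is kept as a
  separate constant.\<close>

definition expm1_quot :: "real \<Rightarrow> real" where
  "expm1_quot x = (exp x - 1) / x"

lemma expm1_quot_strict_mono:
  assumes "0 < x" "x < y" shows "expm1_quot x < expm1_quot y"
proof (rule DERIV_pos_imp_increasing[OF \<open>x < y\<close>])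
  fix z assume "x \<le> z" "z \<le> y"
  with assms have z: "z > 0" by simp
  have "1 - z < exp (- z)" using z by (simp add: exp_minus_greater)
  hence "(1 - z) * exp z < 1"
    by (simp add: exp_minus field_simps)
  hence "0 < (z * exp z - (exp z - 1)) / z\<^sup>2"
    using z by (simp add: algebra_simps)
  moreover have "(expm1_quot has_real_derivative (z * exp z - (exp z - 1)) / z\<^sup>2) (at z)"
    unfolding expm1_quot_def[abs_def] using z
    by (auto intro!: derivative_eq_intros simp: power2_eq_square mult_ac)
  ultimately show "\<exists>y. (expm1_quot has_real_derivative y) (at z) \<and> 0 < y" by blast
qed

lemma expm1_quot_less_iff:
  assumes "0 < x" "0 < y" shows "expm1_quot x < expm1_quot y \<longleftrightarrow> x < y"
  using expm1_quot_strict_mono[of x y] expm1_quot_strict_mono[of y x] assms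
  by (metis linorder_neqE_linordered_idom order.asym)

lemma expm1_quot_le_iff:
  assumes "0 < x" "0 < y" shows "expm1_quot x \<le> expm1_quot y \<longleftrightarrow> x \<le> y"
  using expm1_quot_less_iff[of y x] assms by (simp add: not_less[symmetric])

lemma expm1_quot_pos: "0 < x \<Longrightarrow> 0 < expm1_quot x"
  by (simp add: expm1_quot_def)

lemma continuous_on_expm1_quot: "continuous_on {0<..} expm1_quot"
  unfolding expm1_quot_def[abs_def] by (auto intro!: continuous_intros)

section \<open>The root eta\<close>

lemma is_eta_iff:
  assumes "0 < lam"
  shows "is_eta lam x \<longleftrightarrow> 0 < x \<and> expm1_quot x = 1 / lam"
  using assms by (auto simp: is_eta_def expm1_quot_def field_simps)

lemma is_eta_ex1:
  assumes lam: "0 < lam" "lam < 1"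
  shows "\<exists>!x. is_eta lam x"
proof -
  \<comment> \<open>\<open>a\<close> satisfies e^a = 1 / lam, and the quotient at \<open>a\<close>
    is at most the final slope e^a. At \<open>b\<close> the quadratic Taylor bound makes the
    quotient at least 1 + b / 2, hence at least 1 / lam. Positivity of \<open>a\<close> is where lam
    < 1 enters.\<close>
  define a where "a = - ln lam"
  define b where "b = 2 / lam"
  have a: "0 < a" using lam by (simp add: a_def)
  have b: "0 < b" using lam by (simp add: b_def)
  have "1 - a \<le> exp (- a)" using exp_ge_add_one_self[of "- a"] by simp
  hence "exp a - 1 \<le> a * exp a" by (simp add: exp_minus field_simps)
  hence "expm1_quot a \<le> exp a"
    using a by (simp add: expm1_quot_def divide_le_eq mult.commute)
  hence "expm1_quot a \<le> 1 / lam"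
    using lam by (simp add: a_def exp_minus inverse_eq_divide)
  moreover have "1 + b + b\<^sup>2 / 2 \<le> exp b" using b by (intro exp_lower_Taylor_quadratic) simp
  hence "1 / lam \<le> expm1_quot b"
    using b lam by (simp add: expm1_quot_def b_def field_simps power2_eq_square)
  moreover from calculation have "a \<le> b"
    using expm1_quot_le_iff[OF a b] by simp
  moreover have "continuous_on {a..b} expm1_quot"
    by (rule continuous_on_subset[OF continuous_on_expm1_quot]) (use a in auto)
  ultimately obtain x where "a \<le> x" "x \<le> b" "expm1_quot x = 1 / lam"
    using IVT'[of expm1_quot a "1 / lam" b] by blast
  with a have x: "is_eta lam x" using lam by (simp add: is_eta_iff)
  moreover have "y = x" if "is_eta lam y" for y
    using that x expm1_quot_less_iff[of x y] expm1_quot_less_iff[of y x] lam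
    by (simp add: is_eta_iff)
  ultimately show ?thesis by blast
qed

lemma is_eta_eta: "0 < lam \<Longrightarrow> lam < 1 \<Longrightarrow> is_eta lam (eta lam)"
  unfolding eta_def using is_eta_ex1 by (rule theI')

text \<open>The value of t that the substitution c Gamma(2 - lam) = t^(-lam) assigns to c = 1, the
  end of the range of c.\<close>

definition gam_pow :: "real \<Rightarrow> real" where
  "gam_pow l = Gamma (2 - l) powr (- 1 / l)"

lemma is_lambda_star_iff:
  "is_lambda_star l \<longleftrightarrow> 0 < l \<and> l \<le> 1 \<and> l * expm1_quot (gam_pow l) = 1"
proof (cases "0 < l \<and> l \<le> 1")
  case True
  hence "Gamma (2 - l) > 0" by (intro Gamma_real_pos) simp
  hence t: "gam_pow l > 0" by (simp add: gam_pow_def)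
  have "1 - (1 + t / l) * exp (- t) = 0 \<longleftrightarrow> l * expm1_quot t = 1" if "t > 0" for t
    using that True by (auto simp: expm1_quot_def exp_minus field_simps)
  from this[OF t] True show ?thesis unfolding is_lambda_star_def gam_pow_def by simp
qed (auto simp: is_lambda_star_def)

lemma gam_pow_eq_exp:
  assumes "0 < l" "l \<le> 1" shows "gam_pow l = exp (- ln_Gamma (2 - l) / l)"
proof -
  have "Gamma (2 - l) > 0" using assms by (intro Gamma_real_pos) simp
  hence "Gamma (2 - l) \<noteq> 0" by simp
  thus ?thesis using assms by (simp add: gam_pow_def powr_def ln_Gamma_real_pos)
qed

lemma ln_Gamma_2: "ln_Gamma (2 :: real) = 0"
  using ln_Gamma_real_conv_fact[of 2] by simp

text \<open>Since ln Gamma vanishes at 2, the quotient is the slope of a chord of ln Gamma over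
  [2 - l, 2]. It is also the logarithm of \<open>gam_pow l\<close>, so bounds on Digamma become
  bounds on \<open>gam_pow\<close>.\<close>

lemma neg_ln_Gamma_quot:
  fixes l :: real
  assumes "0 < l" "l \<le> 1"
  obtains z where "2 - l < z" "z < 2" "- ln_Gamma (2 - l) / l = Digamma z"
proof -
  have "\<exists>z>2 - l. z < 2 \<and> ln_Gamma 2 - ln_Gamma (2 - l) = (2 - (2 - l)) * Digamma z"
    using assms by (intro MVT2) (auto intro!: derivative_intros)
  then obtain z where "2 - l < z" "z < 2" "- ln_Gamma (2 - l) = l * Digamma z"
    by (auto simp: ln_Gamma_2)
  thus thesis using that[of z] assms by (simp add: field_simps)
qed

lemma Digamma_2: "Digamma (2::real) = 1 - euler_mascheroni"
  using Digamma_plus1[of "1::real"] by simp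

lemma ln_2_approx: "ln 2 \<in> {0.69314 .. 0.69315 :: real}"
  using ln_approx_bounds[of 2 5] by (simp add: eval_nat_numeral)

lemma euler_mascheroni_approx: "(euler_mascheroni :: real) \<in> {0.5768..0.5791}"
proof -
  have "ln (real (Suc 15)) = 4 * ln 2" by (simp add: ln_powr [symmetric])
  with euler_mascheroni_bounds[of 15] ln_2_approx show ?thesis
    by (simp add: harm_expand)
qed

lemma gam_pow_deriv:
  assumes "0 < l" "l \<le> 1"
  shows "((\<lambda>l. - ln_Gamma (2 - l) / l) has_real_derivative
           (Digamma (2 - l) + ln_Gamma (2 - l) / l) / l) (at l)"
  using assms by (auto intro!: derivative_eq_intros simp: field_simps power2_eq_square)

text \<open>The logarithm of \<open>gam_pow l\<close> is the mean of Digamma over [2 - l, 2]; a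
  larger l extends the interval to the left, where Digamma is smaller.\<close>

lemma gam_pow_less:
  assumes "0 < l" "l < m" "m \<le> 1" shows "gam_pow m < gam_pow l"
proof -
  have "- ln_Gamma (2 - m) / m < - ln_Gamma (2 - l) / l"
  proof (rule DERIV_neg_imp_decreasing[OF \<open>l < m\<close>])
    fix x assume x: "l \<le> x" "x \<le> m"
    then obtain z where z: "2 - x < z" "z < 2" "- ln_Gamma (2 - x) / x = Digamma z"
      using neg_ln_Gamma_quot[of x] assms by auto
    hence "Digamma (2 - x) < Digamma z" using x assms by (intro Digamma_real_strict_mono) auto
    hence "(Digamma (2 - x) + ln_Gamma (2 - x) / x) / x < 0"
      using z(3) x assms by (simp add: divide_neg_pos)
    with gam_pow_deriv[of x] x assms
    show "\<exists>y. ((\<lambda>l. - ln_Gamma (2 - l) / l) has_real_derivative y) (at x) \<and> y < 0" by force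
  qed
  thus ?thesis using assms by (simp add: gam_pow_eq_exp)
qed

text \<open>The logarithmic derivative at x is (1 + Digamma(2 - x) - Digamma z) / x. Both Digamma
  values lie between Digamma 1 and Digamma 2, which differ by exactly 1, and z < 2 makes the
  inequality strict.\<close>

lemma mult_gam_pow_less:
  assumes "0 < l" "l < m" "m \<le> 1" shows "l * gam_pow l < m * gam_pow m"
proof -
  have "ln l + - ln_Gamma (2 - l) / l < ln m + - ln_Gamma (2 - m) / m"
  proof (rule DERIV_pos_imp_increasing[OF \<open>l < m\<close>])
    fix x assume x: "l \<le> x" "x \<le> m"
    then obtain z where z: "2 - x < z" "z < 2" "- ln_Gamma (2 - x) / x = Digamma z"
      using neg_ln_Gamma_quot[of x] assms by auto
    have "Digamma z < Digamma 2" using z x assms by (intro Digamma_real_strict_mono) auto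
    moreover have "Digamma 1 \<le> Digamma (2 - x)" using x assms by (intro Digamma_real_mono) auto
    ultimately have "0 < 1 / x + (Digamma (2 - x) + ln_Gamma (2 - x) / x) / x"
      using z(3) x assms by (simp add: Digamma_2 add_divide_distrib[symmetric])
    moreover have "((\<lambda>l. ln l + - ln_Gamma (2 - l) / l) has_real_derivative
        1 / x + (Digamma (2 - x) + ln_Gamma (2 - x) / x) / x) (at x)"
      using x assms by (intro DERIV_add gam_pow_deriv DERIV_ln_divide) auto
    ultimately show "\<exists>y. ((\<lambda>l. ln l + - ln_Gamma (2 - l) / l) has_real_derivative y) (at x) \<and> 0 < y"
      by blast
  qed
  hence "exp (ln l + - ln_Gamma (2 - l) / l) < exp (ln m + - ln_Gamma (2 - m) / m)" by simp
  thus ?thesis using assms by (simp only: exp_add gam_pow_eq_exp) (simp add: gam_pow_eq_exp)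
qed

lemma gam_pow_pos: "0 < l \<Longrightarrow> l \<le> 1 \<Longrightarrow> 0 < gam_pow l"
  by (simp add: gam_pow_eq_exp)

section \<open>Rational bounds for exp and monotonicity of the equation for lambda_star\<close>

lemma exp_ge_sum:
  fixes x :: real
  assumes "0 \<le> x" shows "(\<Sum>k<n. x ^ k / fact k) \<le> exp x"
  using Maclaurin_exp_le[of x n] assms by auto

text \<open>The factor 9 bounds the exponential in the Lagrange remainder, e^u <= e^2 <= 3 * 3.
  Together with the lower sum it turns numerical claims about exp into rational arithmetic.\<close>

lemma exp_le_sum:
  fixes x :: real
  assumes "0 \<le> x" "x \<le> 2" "0 < n"
  shows "exp x \<le> (\<Sum>k<n. x ^ k / fact k) + 9 * x ^ n / fact n"
proof (cases "x = 0")
  case True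
  thus ?thesis using assms(3) by (cases n) (simp_all add: sum.lessThan_Suc_shift del: sum.lessThan_Suc)
next
  case False
  then obtain u where u: "\<bar>u\<bar> < \<bar>x\<bar>" "exp x = (\<Sum>k<n. x ^ k / fact k) + (exp u / fact n) * x ^ n"
    using Maclaurin_exp_lt[of x n] assms by auto
  have "exp u \<le> exp 2" using u assms by simp
  also have "exp (2::real) = exp 1 * exp 1" by (simp add: exp_add[symmetric])
  also have "\<dots> \<le> 3 * 3" using exp_le by (intro mult_mono) auto
  finally have "(exp u / fact n) * x ^ n \<le> (9 / fact n) * x ^ n"
    using assms by (intro mult_right_mono divide_right_mono) auto
  thus ?thesis using u by simp
qed

text \<open>The supremum is e^(1 - \<gamma>) = 1.526..., with \<gamma> the Euler-Mascheroni
  constant, approached as l tends to 0. The bound matters because (e^t - 1) / t^2 decreases only up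
  to about 1.59.\<close>

lemma gam_pow_le:
  assumes "0 < l" "l \<le> 1" shows "gam_pow l \<le> 1.53"
proof -
  obtain z where z: "2 - l < z" "z < 2" "- ln_Gamma (2 - l) / l = Digamma z"
    using neg_ln_Gamma_quot assms by blast
  have "Digamma z \<le> Digamma 2" using z assms by (intro Digamma_real_mono) auto
  also have "\<dots> \<le> 0.4232" using euler_mascheroni_approx by (simp add: Digamma_2)
  finally have "gam_pow l \<le> exp 0.4232" using z assms by (simp add: gam_pow_eq_exp)
  also have "\<dots> \<le> 1.53" by (rule order.trans[OF exp_le_sum[of _ 6]]) (simp_all add: eval_nat_numeral)
  finally show ?thesis .
qed

text \<open>The derivative has the sign of 2 - (2 - z) e^z. The product (2 - z) e^z starts at 2,
  rises until z = 1 and then falls, staying above 2 until about 1.59. On the rising part a Taylor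
  bound suffices; on the falling part the value at 1.53 decides.\<close>

lemma expm1_quot_div_antimono:
  assumes "0 < x" "x \<le> y" "y \<le> 1.53" shows "expm1_quot y / y \<le> expm1_quot x / x"
proof (rule DERIV_nonpos_imp_nonincreasing[OF \<open>x \<le> y\<close>])
  fix z assume "x \<le> z" "z \<le> y"
  with assms have z: "z > 0" "z \<le> 1.53" by auto
  have key: "2 \<le> (2 - z) * exp z"
  proof (cases "z \<le> 1")
    case True
    have "2 \<le> (2 - z) * (1 + z + z\<^sup>2 / 2)"
    proof -
      have "(2 - z) * (1 + z + z\<^sup>2 / 2) = 2 + z * (1 - z\<^sup>2 / 2)"
        by (simp add: field_simps power2_eq_square)
      moreover have "z\<^sup>2 \<le> 1" using True z by (simp add: power_le_one)
      ultimately show ?thesis using z by simp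
    qed
    also have "\<dots> \<le> (2 - z) * exp z"
      using z True exp_lower_Taylor_quadratic[of z] by (intro mult_left_mono) auto
    finally show ?thesis .
  next
    case False
    have "(2 - 1.53) * exp (1.53::real) \<le> (2 - z) * exp z"
    proof (rule DERIV_nonpos_imp_nonincreasing[OF \<open>z \<le> 1.53\<close>])
      fix w assume "z \<le> w" "w \<le> 1.53"
      hence "(1 - w) * exp w \<le> 0" using False by (simp add: mult_nonpos_nonneg)
      moreover have "((\<lambda>w. (2 - w) * exp w) has_real_derivative (1 - w) * exp w) (at w)"
        by (auto intro!: derivative_eq_intros simp: algebra_simps)
      ultimately show "\<exists>d. ((\<lambda>w. (2 - w) * exp w) has_real_derivative d) (at w) \<and> d \<le> 0"
        by blast
    qed
    moreover have "2 / 0.47 \<le> exp (1.53::real)"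
      by (rule order.trans[OF _ exp_ge_sum[of _ 7]]) (simp_all add: eval_nat_numeral)
    ultimately show ?thesis by (simp add: field_simps)
  qed
  have "((\<lambda>x. expm1_quot x / x) has_real_derivative (z * exp z - 2 * (exp z - 1)) / z ^ 3) (at z)"
    unfolding expm1_quot_def[abs_def] using z
    by (auto intro!: derivative_eq_intros simp: field_simps power2_eq_square power3_eq_cube)
  moreover have "(z * exp z - 2 * (exp z - 1)) / z ^ 3 \<le> 0"
    using key z by (intro divide_nonpos_nonneg) (auto simp: algebra_simps)
  ultimately show "\<exists>d. ((\<lambda>x. expm1_quot x / x) has_real_derivative d) (at z) \<and> d \<le> 0" by blast
qed

lemma star_fun_strict_mono:
  assumes "0 < l" "l < m" "m \<le> 1"
  shows "l * expm1_quot (gam_pow l) < m * expm1_quot (gam_pow m)"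
proof -
  have pos: "0 < gam_pow l" "0 < gam_pow m" using assms by (auto intro: gam_pow_pos)
  have "l * expm1_quot (gam_pow l) = (l * gam_pow l) * (expm1_quot (gam_pow l) / gam_pow l)"
    using pos by simp
  also have "\<dots> < (m * gam_pow m) * (expm1_quot (gam_pow l) / gam_pow l)"
    using mult_gam_pow_less[OF assms] pos expm1_quot_pos
    by (intro mult_strict_right_mono) auto
  also have "\<dots> \<le> (m * gam_pow m) * (expm1_quot (gam_pow m) / gam_pow m)"
    using gam_pow_less[OF assms] gam_pow_le[of l] pos assms
    by (intro mult_left_mono expm1_quot_div_antimono) auto
  also have "\<dots> = m * expm1_quot (gam_pow m)" using pos by simp
  finally show ?thesis .
qed

lemma continuous_on_star_fun: "continuous_on {0<..1} (\<lambda>l. l * expm1_quot (gam_pow l))"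
proof -
  have "continuous_on {0<..1} (\<lambda>l::real. - ln_Gamma (2 - l) / l)"
    by (rule DERIV_continuous_on[OF has_field_derivative_at_within[OF gam_pow_deriv]]) auto
  hence "continuous_on {0<..1} (\<lambda>l. l * expm1_quot (exp (- ln_Gamma (2 - l) / l)))"
    by (intro continuous_on_mult continuous_on_id
        continuous_on_compose2[OF continuous_on_expm1_quot continuous_on_exp]) auto
  thus ?thesis by (rule continuous_on_eq) (simp add: gam_pow_eq_exp)
qed

section \<open>Numerical localisation of lambda_star\<close>

text \<open>The root lies near 1/2, so 2 - l is near 3/2, where Gamma has the closed form sqrt pi /
  2; the expansions of ln Gamma start from this point.\<close>

lemma ln_Gamma_three_halves: "ln_Gamma (3/2 :: real) \<in> {-0.120784..-0.120782}"
proof -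
  have "Gamma (3/2 :: real) = sqrt pi / 2"
    using Gamma_plus1[of "1/2::real"] nonpos_Ints_nonpos[of "1/2::real"]
    by (auto simp: Gamma_one_half_real)
  hence "ln_Gamma (3/2 :: real) = ln (sqrt pi / 2)"
    by (simp add: ln_Gamma_real_pos)
  hence eq: "2 * ln_Gamma (3/2 :: real) = ln (pi / 4)"
    using ln_realpow[of 2 2] by (simp add: ln_div ln_sqrt)
  \<comment> \<open>The Taylor bounds ask for a nonnegative exponent, hence 4 / pi instead of pi /
    4.\<close>
  have "exp (0.241564::real) \<le> 4 / 3.1415926535899"
    by (rule order.trans[OF exp_le_sum[of _ 8]]) (simp_all add: eval_nat_numeral)
  also have "\<dots> \<le> 4 / pi" using pi_approx by (intro divide_left_mono) auto
  finally have "pi / 4 \<le> exp (- 0.241564)" by (simp add: exp_minus field_simps)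
  hence "ln (pi / 4) \<le> ln (exp (- 0.241564))" by (subst ln_le_cancel_iff) simp_all
  hence up: "ln (pi / 4) \<le> - 0.241564" by simp
  have "4 / 3.141592653588 \<le> exp (0.241568::real)"
    by (rule order.trans[OF _ exp_ge_sum[of _ 8]]) (simp_all add: eval_nat_numeral)
  moreover have "4 / pi \<le> 4 / 3.141592653588" using pi_approx by (intro divide_left_mono) auto
  ultimately have "4 / pi \<le> exp 0.241568" by simp
  hence "exp (- 0.241568) \<le> pi / 4" by (simp add: exp_minus field_simps)
  hence "- 0.241568 \<le> ln (pi / 4)" by (subst ln_ge_iff) simp_all
  with up eq show ?thesis by simp
qed

lemma Digamma_three_halves: "Digamma (3/2 :: real) \<in> {0.0346..0.03692}"
  using Digamma_half_integer[of 1, where 'a = real] euler_mascheroni_approx ln_2_approx by simp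

lemma Digamma_deriv:
  "0 < x \<Longrightarrow> (Digamma has_real_derivative Polygamma 1 x) (at x)"
  using has_field_derivative_Polygamma[of x 0] nonpos_Ints_nonpos[of x] by force

text \<open>The argument is 2 - 0.49405. The expansion at 3/2 goes to second order, with 1.12
  dominating the trigamma function to the right of 3/2.\<close>

lemma ln_Gamma_upper: "ln_Gamma (1.50595 :: real) \<le> - 0.120542"
proof -
  let ?f = "\<lambda>x::real. ln_Gamma x - (Digamma (3/2) * (x - 3/2) + 1.12 / 2 * (x - 3/2)\<^sup>2)"
  have "?f 1.50595 \<le> ?f (3/2)"
  proof (rule DERIV_nonpos_imp_nonincreasing[of "3/2" "1.50595" ?f])
    fix x :: real assume x: "3/2 \<le> x" "x \<le> 1.50595"
    have "Digamma x - Digamma (3/2) \<le> 1.12 * (x - 3/2)"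
    proof (cases "x = 3/2")
      case True
      show ?thesis unfolding True by simp
    next
      case False
      with x have "3/2 < x" by simp
      hence "\<exists>z>3/2. z < x \<and> Digamma x - Digamma (3/2) = (x - 3/2) * Polygamma 1 z"
        by (intro MVT2 Digamma_deriv) auto
      then obtain z where z: "3/2 < z" "z < x" "Digamma x - Digamma (3/2) = (x - 3/2) * Polygamma 1 z"
        by blast
      \<comment> \<open>Trigamma decreases, so z may be replaced by 3/2. The recurrence then moves
        to 5/2, where trigamma is at most its mean over [3/2, 5/2]; that mean is Digamma(5/2) -
        Digamma(3/2) = 2/3.\<close>
      have "Polygamma 1 z \<le> Polygamma 1 (3/2)"
        using z Polygamma_real_strict_antimono[of "3/2" z 1] by simp
      also have "\<dots> = Polygamma 1 (5/2) + 4 / 9"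
        using Polygamma_plus1[of "3/2::real" 1] by (simp add: power2_eq_square)
      also have "\<exists>w>3/2. w < 5/2 \<and> Digamma (5/2::real) - Digamma (3/2) = (5/2 - 3/2) * Polygamma 1 w"
        by (intro MVT2 Digamma_deriv) auto
      then obtain w :: real where w: "3/2 < w" "w < 5/2" "Digamma (5/2) - Digamma (3/2) = Polygamma 1 w"
        by auto
      have "Polygamma 1 (5/2) \<le> Polygamma 1 w"
        using w Polygamma_real_strict_antimono[of w "5/2" 1] by simp
      also have "\<dots> = 2 / 3" using w Digamma_plus1[of "3/2::real"] by simp
      finally have "Polygamma 1 z \<le> 2 / 3 + 4 / 9" by simp
      hence "Polygamma 1 z \<le> 1.12" by simp
      hence "(x - 3/2) * Polygamma 1 z \<le> (x - 3/2) * 1.12"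
        using x by (intro mult_left_mono) auto
      thus ?thesis using z by (simp add: mult.commute)
    qed
    moreover have "(?f has_real_derivative Digamma x - (Digamma (3/2) + 1.12 * (x - 3/2))) (at x)"
      using x by (auto intro!: derivative_eq_intros simp: field_simps)
    ultimately show "\<exists>d. (?f has_real_derivative d) (at x) \<and> d \<le> 0"
      by - (rule exI, rule conjI, assumption, linarith)
  qed simp
  thus ?thesis using ln_Gamma_three_halves Digamma_three_halves by (simp add: power2_eq_square)
qed

text \<open>The argument is 2 - 0.49395. By convexity of ln Gamma the tangent at 3/2 is a lower
  bound, so first order suffices.\<close>

lemma ln_Gamma_lower: "- 0.120575 \<le> ln_Gamma (1.50605 :: real)"
proof -
  have "\<exists>z>3/2. z < 1.50605 \<and> ln_Gamma (1.50605::real) - ln_Gamma (3/2) = (1.50605 - 3/2) * Digamma z"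
    by (intro MVT2) (auto intro!: derivative_intros)
  then obtain z :: real where z: "3/2 < z" "ln_Gamma 1.50605 - ln_Gamma (3/2) = 0.00605 * Digamma z"
    by auto
  have "Digamma (3/2) \<le> Digamma z" using z by (intro Digamma_real_mono) auto
  with z ln_Gamma_three_halves Digamma_three_halves show ?thesis by simp
qed

text \<open>0.49395 is the left end of the claimed tolerance and 1.27648 a decimal majorant of
  \<open>gam_pow\<close> there; at the right end 0.49405 the minorant 1.276327 plays the same
  part.\<close>

lemma star_fun_upper: "0.49395 * expm1_quot (gam_pow 0.49395) < 1"
proof -
  have "gam_pow 0.49395 \<le> exp (0.120575 / 0.49395)"
    using ln_Gamma_lower by (simp add: gam_pow_eq_exp)
  also have "\<dots> \<le> 1.27648" by (rule order.trans[OF exp_le_sum[of _ 8]]) (simp_all add: eval_nat_numeral)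
  finally have "expm1_quot (gam_pow 0.49395) \<le> expm1_quot 1.27648"
    by (subst expm1_quot_le_iff) (auto intro: gam_pow_pos)
  also have "exp (1.27648::real) < 1 + 1.27648 / 0.49395"
    by (rule order.strict_trans1[OF exp_le_sum[of _ 13]]) (simp_all add: eval_nat_numeral)
  hence "expm1_quot 1.27648 < 1 / 0.49395" by (simp add: expm1_quot_def)
  finally show ?thesis by simp
qed

lemma star_fun_lower: "1 < 0.49405 * expm1_quot (gam_pow 0.49405)"
proof -
  have "1.276327 \<le> exp (0.120542 / 0.49405 :: real)"
    by (rule order.trans[OF _ exp_ge_sum[of _ 8]]) (simp_all add: eval_nat_numeral)
  also have "\<dots> \<le> gam_pow 0.49405"
    using ln_Gamma_upper by (simp add: gam_pow_eq_exp)
  finally have le: "expm1_quot 1.276327 \<le> expm1_quot (gam_pow 0.49405)"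
    by (subst expm1_quot_le_iff) auto
  have "1 + 1.276327 / 0.49405 < exp (1.276327::real)"
    by (rule order.strict_trans2[OF _ exp_ge_sum[of _ 13]]) (simp_all add: eval_nat_numeral)
  hence "1 / 0.49405 < expm1_quot 1.276327" by (simp add: expm1_quot_def)
  also note le
  finally show ?thesis by simp
qed

lemma is_lambda_star_ex1: "\<exists>!l. is_lambda_star l"
  and lambda_star_approx: "\<bar>lambda_star - 0.4940\<bar> < 0.00005"
  and is_lambda_star_lambda_star: "is_lambda_star lambda_star"
proof -
  have "\<exists>l\<ge>0.49395. l \<le> 0.49405 \<and> l * expm1_quot (gam_pow l) = 1"
    using star_fun_lower star_fun_upper
    by (intro IVT' continuous_on_subset[OF continuous_on_star_fun]) auto
  then obtain l where l: "0.49395 \<le> l" "l \<le> 0.49405" "l * expm1_quot (gam_pow l) = 1" by blast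
  have uniq: "m = l" if "is_lambda_star m" for m
    using that l star_fun_strict_mono[of l m] star_fun_strict_mono[of m l]
    by (cases l m rule: linorder_cases) (auto simp: is_lambda_star_iff)
  have star: "is_lambda_star l" using l by (simp add: is_lambda_star_iff)
  with uniq show "\<exists>!l. is_lambda_star l" by blast
  have eq: "lambda_star = l" unfolding lambda_star_def using star uniq by blast
  with star show "is_lambda_star lambda_star" by simp
  have "l \<noteq> 0.49395" "l \<noteq> 0.49405"
    using l(3) star_fun_lower star_fun_upper by (metis order.irrefl)+
  with l have "0.49395 < l" "l < 0.49405" by auto
  thus "\<bar>lambda_star - 0.4940\<bar> < 0.00005" unfolding eq abs_less_iff by simp
qed

lemma lambda_star_bounds: "0 < lambda_star" "lambda_star < 1"
  using lambda_star_approx unfolding abs_less_iff by simp_all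

lemma le_lambda_star_iff:
  assumes "0 < l" "l \<le> 1"
  shows "l \<le> lambda_star \<longleftrightarrow> l * expm1_quot (gam_pow l) \<le> 1"
    and "lambda_star \<le> l \<longleftrightarrow> 1 \<le> l * expm1_quot (gam_pow l)"
  using is_lambda_star_lambda_star assms
    star_fun_strict_mono[of l lambda_star] star_fun_strict_mono[of lambda_star l]
  by (cases l lambda_star rule: linorder_cases; auto simp: is_lambda_star_iff)+

subsection \<open>The supremum of the limiting price curve\<close>

text \<open>The substitution $c\,\Gamma(2-\lambda) = t^{-\lambda}$ turns \<^term>\<open>g lam c\<close> into this
  function of \<open>t\<close>, up to the factor $\Gamma(2-\lambda)$.\<close>
definition price_curve :: "real \<Rightarrow> real \<Rightarrow> real" where
  "price_curve lam t = t powr (- lam) * (1 - exp (- t))"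

lemma price_curve_deriv:
  assumes "0 < t" "0 < lam"
  shows "(price_curve lam has_real_derivative
           t powr (- lam) * exp (- t) * (1 - lam * expm1_quot t)) (at t)"
  unfolding price_curve_def[abs_def] using assms
  by (auto intro!: derivative_eq_intros
      simp: expm1_quot_def powr_diff exp_minus field_simps)

text \<open>The t of the maximiser: the critical point \<open>eta\<close> while it lies in the
  admissible range t >= \<open>gam_pow lam\<close>, and the end of that range otherwise. At
  \<open>lambda_star\<close> the two coincide.\<close>

definition opt_time :: "real \<Rightarrow> real" where
  "opt_time lam = (if lam \<le> lambda_star then eta lam else gam_pow lam)"

context
  fixes lam :: real
  assumes lam: "0 < lam" "lam \<le> 1"
begin

lemma opt_time_pos: "0 < opt_time lam"
  using lam is_eta_eta[of lam] lambda_star_bounds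
  by (auto simp: opt_time_def is_eta_def intro!: gam_pow_pos)

lemma expm1_quot_eta:
  assumes "lam < 1" shows "lam * expm1_quot (eta lam) = 1"
  using is_eta_eta[of lam] lam assms by (simp add: is_eta_iff)

text \<open>Serves twice: it makes \<open>price_curve\<close> decrease beyond
  \<open>opt_time\<close>, and it makes the intercept of the tangent nonnegative.\<close>

lemma expm1_quot_opt_time: "1 \<le> lam * expm1_quot (opt_time lam)"
proof (cases "lam \<le> lambda_star")
  case True
  thus ?thesis using expm1_quot_eta lambda_star_bounds by (simp add: opt_time_def)
next
  case False
  thus ?thesis using le_lambda_star_iff(2)[of lam] lam by (simp add: opt_time_def)
qed

lemma gam_pow_le_opt_time: "gam_pow lam \<le> opt_time lam"
proof (cases "lam \<le> lambda_star")
  case True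
  hence lam1: "lam < 1" using lambda_star_bounds by simp
  have "lam * expm1_quot (gam_pow lam) \<le> lam * expm1_quot (eta lam)"
    using True le_lambda_star_iff(1)[of lam] lam expm1_quot_eta[OF lam1] by simp
  hence "expm1_quot (gam_pow lam) \<le> expm1_quot (eta lam)" using lam by simp
  thus ?thesis using True is_eta_eta[of lam] lam lam1
    by (subst (asm) expm1_quot_le_iff) (auto simp: opt_time_def is_eta_def gam_pow_pos)
qed (simp add: opt_time_def)

text \<open>The derivative has the sign of \<open>1 - lam * expm1_quot t\<close>, which changes
  once, from plus to minus. The condition on t is c <= 1 in disguise; a rising stretch inside this
  range exists only for lam <= \<open>lambda_star\<close>.\<close>

lemma price_curve_le_opt_time:
  assumes "gam_pow lam \<le> t" shows "price_curve lam t \<le> price_curve lam (opt_time lam)"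
proof (cases "t \<le> opt_time lam")
  case True
  have "0 < t" using assms gam_pow_pos[of lam] lam by simp
  have "lam \<le> lambda_star \<or> t = opt_time lam"
    using True assms by (auto simp: opt_time_def)
  thus ?thesis
  proof
    assume l: "lam \<le> lambda_star"
    hence eq: "opt_time lam = eta lam" and lam1: "lam < 1"
      using lambda_star_bounds by (auto simp: opt_time_def)
    show ?thesis
    proof (rule DERIV_nonneg_imp_nondecreasing[OF True])
      fix x assume x: "t \<le> x" "x \<le> opt_time lam"
      have "expm1_quot x \<le> expm1_quot (eta lam)"
        using x eq \<open>0 < t\<close> by (subst expm1_quot_le_iff) auto
      hence "lam * expm1_quot x \<le> 1"
        using mult_left_mono[of "expm1_quot x" "expm1_quot (eta lam)" lam] lam expm1_quot_eta[OF lam1] by simp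
      thus "\<exists>y. (price_curve lam has_real_derivative y) (at x) \<and> 0 \<le> y"
        using price_curve_deriv[of x lam] x \<open>0 < t\<close> lam by (intro exI conjI) auto
    qed
  qed simp
next
  case False
  hence "opt_time lam \<le> t" by simp
  thus ?thesis
  proof (rule DERIV_nonpos_imp_nonincreasing)
    fix x assume x: "opt_time lam \<le> x" "x \<le> t"
    have "0 < x" using x opt_time_pos by simp
    have "expm1_quot (opt_time lam) \<le> expm1_quot x"
      using x opt_time_pos by (subst expm1_quot_le_iff) auto
    hence "lam * expm1_quot (opt_time lam) \<le> lam * expm1_quot x"
      using lam by (intro mult_left_mono) auto
    hence "1 \<le> lam * expm1_quot x" using expm1_quot_opt_time by simp
    thus "\<exists>y. (price_curve lam has_real_derivative y) (at x) \<and> y \<le> 0"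
      using price_curve_deriv[of x lam] \<open>0 < x\<close> lam
      by (intro exI[of _ "x powr (- lam) * exp (- x) * (1 - lam * expm1_quot x)"])
        (auto intro!: mult_nonneg_nonpos)
  qed
qed

lemma Gamma_pos: "0 < Gamma (2 - lam)"
  using lam by (intro Gamma_real_pos) simp

lemma gam_pow_powr: "gam_pow lam powr (- lam) = Gamma (2 - lam)"
  using lam Gamma_pos by (simp add: gam_pow_def powr_powr)

lemma g_eq_price_curve:
  assumes "0 < c"
  shows "g lam c = price_curve lam ((c * Gamma (2 - lam)) powr (- 1 / lam)) / Gamma (2 - lam)"
  using lam assms Gamma_pos by (simp add: g_def price_curve_def powr_powr)

lemma g_attained:
  obtains c where "0 < c" "c \<le> 1" "g lam c = price_curve lam (opt_time lam) / Gamma (2 - lam)"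
proof -
  define c where "c = opt_time lam powr (- lam) / Gamma (2 - lam)"
  have "opt_time lam powr (- lam) \<le> gam_pow lam powr (- lam)"
    using gam_pow_le_opt_time lam gam_pow_pos by (intro powr_mono2') auto
  hence c: "0 < c" "c \<le> 1"
    using Gamma_pos opt_time_pos by (auto simp: c_def gam_pow_powr)
  have "(c * Gamma (2 - lam)) powr (- 1 / lam) = opt_time lam"
    using lam less_imp_neq[OF Gamma_pos] opt_time_pos by (simp add: c_def powr_powr)
  hence "g lam c = price_curve lam (opt_time lam) / Gamma (2 - lam)"
    using g_eq_price_curve[OF c(1)] by simp
  with c that show thesis by blast
qed

lemma SUP_g: "(SUP c\<in>{0..1}. g lam c) = price_curve lam (opt_time lam) / Gamma (2 - lam)"
proof (rule cSup_eq_maximum)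
  obtain c where "0 < c" "c \<le> 1" "g lam c = price_curve lam (opt_time lam) / Gamma (2 - lam)"
    by (rule g_attained)
  thus "price_curve lam (opt_time lam) / Gamma (2 - lam) \<in> g lam ` {0..1}"
    by (metis imageI atLeastAtMost_iff less_imp_le)
next
  fix y assume "y \<in> g lam ` {0..1}"
  then obtain c where c: "0 \<le> c" "c \<le> 1" "y = g lam c" by auto
  show "y \<le> price_curve lam (opt_time lam) / Gamma (2 - lam)"
  proof (cases "c = 0")
    case True
    thus ?thesis using c opt_time_pos Gamma_pos by (simp add: g_def price_curve_def)
  next
    case False
    hence c0: "0 < c" using c by simp
    have "gam_pow lam \<le> (c * Gamma (2 - lam)) powr (- 1 / lam)"
      unfolding gam_pow_def using c c0 Gamma_pos lam by (intro powr_mono2') auto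
    thus ?thesis using c g_eq_price_curve[OF c0] Gamma_pos
      by (auto intro!: divide_right_mono price_curve_le_opt_time)
  qed
qed

lemma inverse_SUP_g: "1 / (SUP c\<in>{0..1}. g lam c) = Gamma (2 - lam) / price_curve lam (opt_time lam)"
  by (simp add: SUP_g)

lemma inverse_SUP_g_small:
  assumes "lam \<le> lambda_star"
  shows "1 / (SUP c\<in>{0..1}. g lam c) = Gamma (2 - lam) * (lam + eta lam) / eta lam powr (1 - lam)"
proof -
  have eq: "opt_time lam = eta lam" and lam1: "lam < 1"
    using assms lambda_star_bounds by (auto simp: opt_time_def)
  have e: "0 < eta lam" "exp (eta lam) = 1 + eta lam / lam"
    using is_eta_eta[of lam] lam lam1 by (auto simp: is_eta_def)
  have "price_curve lam (eta lam) = eta lam powr (- lam) * (eta lam / (lam + eta lam))"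
    using e(1) lam by (simp add: price_curve_def exp_minus e(2) field_simps)
  also have "\<dots> = eta lam powr (1 - lam) / (lam + eta lam)"
    using e(1) by (simp add: powr_diff powr_minus field_simps)
  finally show ?thesis unfolding inverse_SUP_g eq by simp
qed

lemma inverse_SUP_g_large:
  assumes "lambda_star \<le> lam"
  shows "1 / (SUP c\<in>{0..1}. g lam c) = 1 / (1 - exp (- (Gamma (2 - lam) powr (- 1 / lam))))"
proof -
  have "opt_time lam = gam_pow lam"
  proof (cases "lam = lambda_star")
    case True
    have lam1: "lam < 1" using True lambda_star_bounds by simp
    have "lam * expm1_quot (gam_pow lam) = 1"
      using is_lambda_star_lambda_star True by (simp add: is_lambda_star_iff)
    hence "is_eta lam (gam_pow lam)"
      using lam gam_pow_pos[of lam] by (simp add: is_eta_iff field_simps)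
    hence "eta lam = gam_pow lam"
      using is_eta_ex1[OF lam(1) lam1] is_eta_eta[OF lam(1) lam1] by blast
    thus ?thesis using True by (simp add: opt_time_def)
  qed (use assms in \<open>simp add: opt_time_def\<close>)
  thus ?thesis using Gamma_pos
    unfolding inverse_SUP_g by (simp add: price_curve_def gam_pow_powr) (simp add: gam_pow_def)
qed

end

section \<open>The tangent to 1 / (1 - e^(-t)) in the variable s\<close>

lemma x_div_sinh_antimono:
  fixes x y :: real
  assumes "0 < x" "x \<le> y" shows "y / sinh y \<le> x / sinh x"
proof (rule DERIV_nonpos_imp_nonincreasing[OF \<open>x \<le> y\<close>])
  fix z assume "x \<le> z" "z \<le> y"
  hence z: "0 < z" using assms by simp
  have "sinh 0 - 0 * cosh 0 \<ge> sinh z - z * cosh z"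
  proof (rule DERIV_nonpos_imp_nonincreasing[of 0 z "\<lambda>w. sinh w - w * cosh w"])
    fix w :: real assume w: "0 \<le> w" "w \<le> z"
    have "((\<lambda>w. sinh w - w * cosh w) has_real_derivative - (w * sinh w)) (at w)"
      by (auto intro!: derivative_eq_intros simp: algebra_simps)
    moreover have "- (w * sinh w) \<le> 0" using w by simp
    ultimately show "\<exists>d. ((\<lambda>w. sinh w - w * cosh w) has_real_derivative d) (at w) \<and> d \<le> 0" by blast
  qed (use z in simp)
  hence "(sinh z - z * cosh z) / (sinh z)\<^sup>2 \<le> 0" by (intro divide_nonpos_nonneg) auto
  moreover have "((\<lambda>z. z / sinh z) has_real_derivative (sinh z - z * cosh z) / (sinh z)\<^sup>2) (at z)"
    using z by (auto intro!: derivative_eq_intros simp: power2_eq_square)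
  ultimately show "\<exists>d. ((\<lambda>z. z / sinh z) has_real_derivative d) (at z) \<and> d \<le> 0" by blast
qed

text \<open>Divided by lam, this is the derivative of 1 / (1 - e^(-t)) with respect to s = t^(-lam).
  The sinh form exhibits two factors decreasing in t, the first because lam <= 1; since s decreases
  in t, the monotonicity is convexity in s.\<close>

definition slope_fun :: "real \<Rightarrow> real \<Rightarrow> real" where
  "slope_fun lam t = t powr (lam - 1) * (t / 2 / sinh (t / 2))\<^sup>2"

lemma slope_fun_antimono:
  assumes "0 < x" "x \<le> y" "lam \<le> 1" shows "slope_fun lam y \<le> slope_fun lam x"
  unfolding slope_fun_def using assms x_div_sinh_antimono[of "x/2" "y/2"]
  by (intro mult_mono power_mono powr_mono2') auto

lemma slope_fun_eq:
  assumes "0 < t" shows "slope_fun lam t = t powr lam * t * exp (- t) / (1 - exp (- t))\<^sup>2"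
proof -
  have "(sinh (t/2))\<^sup>2 * 4 = exp t * (1 - exp (- t))\<^sup>2"
  proof -
    define u where "u = exp (t / 2)"
    have "exp t = u * u" "0 < u" by (simp_all add: u_def exp_add[symmetric])
    thus ?thesis
      by (simp add: sinh_field_def exp_minus u_def[symmetric] power2_eq_square field_simps)
  qed
  hence "(t / 2 / sinh (t / 2))\<^sup>2 = t\<^sup>2 / (exp t * (1 - exp (- t))\<^sup>2)"
    by (metis power_divide mult.commute divide_divide_eq_left power2_eq_square mult_2 numeral_Bit0 four_x_squared power_mult_distrib)
  hence "slope_fun lam t = t powr (lam - 1) * (t\<^sup>2 / (exp t * (1 - exp (- t))\<^sup>2))"
    by (simp add: slope_fun_def)
  also have "t powr (lam - 1) * (t\<^sup>2 / (exp t * c)) = t powr lam * t * exp (- t) / c" for c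
    using assms by (cases "c = 0") (simp_all add: powr_diff exp_minus power2_eq_square field_simps)
  finally show ?thesis .
qed

text \<open>Concave quantile functions are compared with the price curve through a line in $s = t^{-\lambda}$:
  $1/(1 - e^{-t})$ is convex in $s$, and the line is its tangent.\<close>
lemma tangent_line:
  fixes lam t0 :: real
  assumes lam: "0 < lam" "lam \<le> 1" and t0: "0 < t0"
  defines "a \<equiv> slope_fun lam t0 / lam"
  defines "b \<equiv> 1 / (1 - exp (- t0)) - a * t0 powr (- lam)"
  assumes t: "0 < t"
  shows "a * t powr (- lam) + b \<le> 1 / (1 - exp (- t))"
proof -
  define D where "D t = 1 / (1 - exp (- t)) - a * t powr (- lam) - b" for t
  define D' where "D' t = t powr (- lam) / t * (slope_fun lam t0 - slope_fun lam t)" for t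
  have deriv: "(D has_real_derivative D' t) (at t)" if "0 < t" for t
    unfolding D_def[abs_def] D'_def slope_fun_eq[OF that] a_def using that lam
    by (auto intro!: derivative_eq_intros simp: powr_diff powr_minus field_simps power2_eq_square)
  have "D t0 \<le> D t"
  proof (cases "t0 \<le> t")
    case True
    thus ?thesis
    proof (rule DERIV_nonneg_imp_nondecreasing)
      fix x assume "t0 \<le> x" "x \<le> t"
      with t0 lam slope_fun_antimono[of t0 x lam] deriv[of x]
      show "\<exists>y. (D has_real_derivative y) (at x) \<and> 0 \<le> y"
        by (intro exI[of _ "D' x"]) (auto simp: D'_def)
    qed
  next
    case False
    hence "t \<le> t0" by simp
    thus ?thesis
    proof (rule DERIV_nonpos_imp_nonincreasing)
      fix x assume "t \<le> x" "x \<le> t0"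
      with t lam slope_fun_antimono[of x t0 lam] deriv[of x]
      show "\<exists>y. (D has_real_derivative y) (at x) \<and> y \<le> 0"
        by (intro exI[of _ "D' x"]) (auto simp: D'_def simp del: times_divide_eq_left
            intro!: mult_nonneg_nonpos)
    qed
  qed
  moreover have "D t0 = 0" by (simp add: D_def b_def)
  ultimately show ?thesis by (simp add: D_def)
qed

text \<open>In this form the intercept visibly vanishes at the critical points of
  \<open>price_curve\<close> and is nonnegative where \<open>price_curve\<close> has nonpositive
  derivative.\<close>

lemma tangent_intercept:
  fixes lam t0 :: real
  assumes lam: "0 < lam" and t0: "0 < t0"
  shows "1 / (1 - exp (- t0)) - slope_fun lam t0 / lam * t0 powr (- lam)
    = (1 - 1 / (lam * expm1_quot t0)) / (1 - exp (- t0))"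
proof -
  define d where "d = 1 - exp (- t0)"
  have d: "0 < d" "d < 1" using t0 by (auto simp: d_def)
  have e: "exp (- t0) = 1 - d" "exp t0 = 1 / (1 - d)"
    by (auto simp: d_def exp_minus inverse_eq_divide)
  have "1 / d - t0 * (1 - d) / d\<^sup>2 / lam = (1 - 1 / (lam * ((1 / (1 - d) - 1) / t0))) / d"
    using d assms by (simp add: field_simps power2_eq_square)
  moreover have "t0 powr lam * t0 * (1 - d) / d\<^sup>2 / lam * t0 powr (- lam) = t0 * (1 - d) / d\<^sup>2 / lam"
    using assms by (simp add: powr_minus)
  ultimately show ?thesis
    unfolding slope_fun_eq[OF t0] expm1_quot_def d_def[symmetric] unfolding e by (simp only:)
qed

lemma exists_line:
  assumes lam: "0 < lam" "lam \<le> 1"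
  obtains a b where "0 < a" "0 \<le> b"
    "\<forall>t>0. (a * t powr (- lam) + b) * (1 - exp (- t)) \<le> 1"
    "a * Gamma (2 - lam) + b = 1 / (SUP c\<in>{0..1}. g lam c)"
proof -
  define t0 where "t0 = opt_time lam"
  define a where "a = slope_fun lam t0 / lam"
  define b where "b = 1 / (1 - exp (- t0)) - a * t0 powr (- lam)"
  have t0: "0 < t0" unfolding t0_def by (rule opt_time_pos[OF lam])
  have b_eq: "b = (1 - 1 / (lam * expm1_quot t0)) / (1 - exp (- t0))"
    unfolding b_def a_def by (rule tangent_intercept[OF lam(1) t0])
  have K: "1 / (SUP c\<in>{0..1}. g lam c) = Gamma (2 - lam) * (a * t0 powr (- lam) + b) * t0 powr lam"
    using t0 unfolding inverse_SUP_g[OF lam]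
    by (simp add: b_def price_curve_def t0_def[symmetric] powr_minus field_simps)
  show thesis
  proof (rule that)
    show "0 < a" using t0 lam by (simp add: a_def slope_fun_def)
    show "0 \<le> b" unfolding b_eq using expm1_quot_opt_time[OF lam] t0
      by (simp add: t0_def[symmetric])
    show "\<forall>t>0. (a * t powr (- lam) + b) * (1 - exp (- t)) \<le> 1"
      using tangent_line[OF lam t0] by (simp add: a_def b_def pos_le_divide_eq)
    show "a * Gamma (2 - lam) + b = 1 / (SUP c\<in>{0..1}. g lam c)"
    \<comment> \<open>In the first case the line is a multiple of s, so moving from t0^(-lam) to
      Gamma(2 - lam) rescales its height; in the second the tangency point already is s = Gamma(2 -
      lam).\<close>
    proof (cases "lam \<le> lambda_star")
      case True
      hence "lam * expm1_quot t0 = 1"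
        using expm1_quot_eta[OF lam] lambda_star_bounds by (simp add: t0_def opt_time_def)
      hence "b = 0" unfolding b_eq by simp
      thus ?thesis unfolding K using t0 by (simp add: powr_minus)
    next
      case False
      hence "t0 powr (- lam) = Gamma (2 - lam)"
        using gam_pow_powr[OF lam] by (simp add: t0_def opt_time_def)
      moreover have "t0 powr lam * t0 powr (- lam) = 1" using t0 by (simp add: powr_minus)
      ultimately show ?thesis unfolding K by (simp add: mult.commute mult.left_commute)
    qed
  qed
qed

subsection \<open>Minima of quantiles\<close>

definition ccdf :: "real measure \<Rightarrow> real \<Rightarrow> real" where
  "ccdf M x = 1 - cdf M x"

text \<open>The law of the minimum of \<open>k\<close> independent uniform variables on $[0,1]$.\<close>
definition min_uniform :: "nat \<Rightarrow> real measure" where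
  "min_uniform k = density lborel (\<lambda>u. indicator {0..1} u * ennreal (real k * (1 - u) ^ (k - 1)))"

lemma sets_min_uniform [simp, measurable_cong]: "sets (min_uniform k) = sets borel"
  by (simp add: min_uniform_def)

lemma emeasure_min_uniform:
  assumes k: "0 < k"
  shows "emeasure (min_uniform k) {u<..} = ennreal (1 - max 0 (min 1 u)) ^ k"
proof -
  define a where "a = max 0 (min 1 u)"
  have a: "0 \<le> a" "a \<le> 1" by (auto simp: a_def)
  have "emeasure (min_uniform k) {u<..}
      = (\<integral>\<^sup>+t. indicator {0..1} t * ennreal (real k * (1 - t) ^ (k - 1)) * indicator {u<..} t \<partial>lborel)"
    unfolding min_uniform_def by (subst emeasure_density) auto
  also have "\<dots> = (\<integral>\<^sup>+t. ennreal (real k * (1 - t) ^ (k - 1)) * indicator {a..1} t \<partial>lborel)"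
  proof (rule nn_integral_cong_AE, rule AE_mp[OF AE_lborel_singleton[of u]], rule AE_mp[OF AE_lborel_singleton[of 1]], rule AE_I2, intro impI)
    fix x :: real assume "x \<noteq> u" "x \<noteq> 1"
    thus "indicator {0..1} x * ennreal (real k * (1 - x) ^ (k - 1)) * indicator {u<..} x
      = ennreal (real k * (1 - x) ^ (k - 1)) * indicator {a..1} x"
      by (auto simp: a_def indicator_def)
  qed
  also have "\<dots> = ennreal (- ((1 - 1) ^ k) - (- ((1 - a) ^ k)))"
    using a k by (intro nn_integral_FTC_Icc)
      (auto intro!: derivative_eq_intros simp: of_nat_diff)
  also have "\<dots> = ennreal (1 - a) ^ k" using k a by (simp add: ennreal_power)
  finally show ?thesis unfolding a_def .
qed

section \<open>Quantiles of atomless distributions\<close>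

locale atomless_distribution = real_distribution +
  assumes atomless: "measure M {x} = 0"
begin

lemma isCont_ccdf: "isCont (ccdf M) x"
  unfolding ccdf_def using isCont_cdf[of x] atomless by (auto intro!: continuous_intros)

lemma ccdf_eq: "ccdf M x = measure M {x<..}"
  using prob_compl[of "{..x}"] by (simp add: ccdf_def cdf_def Compl_eq_Diff_UNIV[symmetric])

lemma ccdf_eq_Ici: "ccdf M x = measure M {x..}"
proof -
  have "measure M {x..} = measure M {x} + measure M {x<..}"
    by (subst finite_measure_Union[symmetric]) (auto intro!: arg_cong[of _ _ "measure M"])
  thus ?thesis using atomless by (simp add: ccdf_eq)
qed

lemma ccdf_nonneg: "0 \<le> ccdf M x" and ccdf_le_1: "ccdf M x \<le> 1"
  by (simp_all add: ccdf_eq)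

lemma ccdf_antimono: "x \<le> y \<Longrightarrow> ccdf M y \<le> ccdf M x"
  unfolding ccdf_def using cdf_nondecreasing by simp

lemma ccdf_measurable [measurable]: "ccdf M \<in> borel_measurable borel"
  using isCont_ccdf by (intro borel_measurable_continuous_onI continuous_at_imp_continuous_on) auto

lemma ccdf_attained:
  assumes "0 < u" "u < 1" obtains x where "ccdf M x = u"
proof -
  have "eventually (\<lambda>x. 1 - u < cdf M x) at_top"
    using cdf_lim_at_top_prob assms by (intro order_tendstoD) auto
  then obtain b where b: "ccdf M b < u" unfolding ccdf_def eventually_at_top_linorder
    by (metis add.commute diff_less_eq order.refl)
  have "eventually (\<lambda>x. cdf M x < 1 - u) at_bot"
    using cdf_lim_at_bot assms by (intro order_tendstoD) auto
  then obtain a where a: "u < ccdf M a" unfolding ccdf_def eventually_at_bot_linorder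
    by (metis add.commute less_diff_eq order.refl)
  have "a \<le> b" using a b ccdf_antimono[of b a] by linarith
  thus thesis using that IVT2[of "ccdf M" b u a] a b isCont_ccdf by force
qed

text \<open>Flat pieces of the cdf rule out inverting \<open>ccdf M\<close>. Instead the event is
  squeezed between half-lines: one ends at a point of tail exactly u, the other at a point of tail v
  slightly above u.\<close>

lemma emeasure_ccdf_gt: "emeasure M {x. u < ccdf M x} = ennreal (1 - max 0 (min 1 u))"
proof -
  consider "u < 0" | "1 \<le> u" | "0 \<le> u" "u < 1" by linarith
  thus ?thesis
  proof cases
    case 1
    hence "{x. u < ccdf M x} = space M" using ccdf_nonneg by (auto intro: less_le_trans)
    thus ?thesis using 1 by (simp add: emeasure_space_1 del: space_eq_univ)
  next
    case 2
    hence "{x. u < ccdf M x} = {}" by (auto simp: not_less intro: order.trans[OF ccdf_le_1])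
    thus ?thesis using 2 by simp
  next
    case 3
    have upper: "prob {x. u < ccdf M x} \<le> 1 - u"
    proof (cases "u = 0")
      case False
      then obtain x where x: "ccdf M x = u" using ccdf_attained[of u] 3 by auto
      have "prob {y. u < ccdf M y} \<le> prob {..x}"
      proof (rule finite_measure_mono)
        show "{y. u < ccdf M y} \<subseteq> {..x}"
        proof
          fix y assume "y \<in> {y. u < ccdf M y}"
          thus "y \<in> {..x}" using x ccdf_antimono[of x y] by (cases "x \<le> y") auto
        qed
      qed simp
      also have "\<dots> = 1 - u" using x by (simp add: ccdf_def cdf_def)
      finally show ?thesis .
    qed simp
    have lower: "1 - v \<le> prob {x. u < ccdf M x}" if v: "u < v" "v < 1" for v
    proof -
      obtain x where x: "ccdf M x = v" using ccdf_attained[of v] v 3 by auto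
      have "prob {..x} \<le> prob {y. u < ccdf M y}"
      proof (rule finite_measure_mono)
        show "{..x} \<subseteq> {y. u < ccdf M y}" using x v ccdf_antimono[of _ x] by force
      qed simp
      thus ?thesis using x by (simp add: ccdf_def cdf_def)
    qed
    have "1 - u \<le> prob {x. u < ccdf M x}"
    proof (rule field_le_epsilon)
      fix e :: real assume e: "0 < e"
      \<comment> \<open>The second term keeps v below 1 when e is large.\<close>
      define v where "v = min (u + e) ((1 + u) / 2)"
      have "u < v" "v < 1" "v \<le> u + e" unfolding v_def using e 3 by (simp_all add: min_less_iff_disj)
      with lower[of v] show "1 - u \<le> prob {x. u < ccdf M x} + e" by simp
    qed
    with upper have "prob {x. u < ccdf M x} = 1 - u" by simp
    thus ?thesis using 3 by (simp add: emeasure_eq_measure)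
  qed
qed

lemma distr_ccdf: "distr M borel (ccdf M) = min_uniform 1"
proof (rule measure_eqI_lessThan)
  fix x
  have "emeasure (distr M borel (ccdf M)) {x<..} = emeasure M {y. x < ccdf M y}"
    by (subst emeasure_distr) (auto simp: vimage_def)
  also have "\<dots> = emeasure (min_uniform 1) {x<..}"
    by (simp add: emeasure_ccdf_gt emeasure_min_uniform)
  finally show "emeasure (distr M borel (ccdf M)) {x<..} = emeasure (min_uniform 1) {x<..}" .
  show "emeasure (distr M borel (ccdf M)) {x<..} < \<infinity>"
    by (subst emeasure_distr) (auto simp: vimage_def emeasure_eq_measure)
qed simp_all

lemma AE_ccdf_pos: "AE x in M. 0 < ccdf M x"
proof (rule AE_I')
  have "emeasure M {x. 0 < ccdf M x} = 1" by (simp add: emeasure_ccdf_gt)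
  hence "prob {x. 0 < ccdf M x} = 1" by (simp add: emeasure_eq_measure)
  hence "prob {x. \<not> 0 < ccdf M x} = 0"
    using prob_compl[of "{x. 0 < ccdf M x}"] by (simp add: Compl_eq_Diff_UNIV[symmetric] Collect_neg_eq)
  thus "{x. \<not> 0 < ccdf M x} \<in> null_sets M" by (auto simp: null_sets_def emeasure_eq_measure)
qed auto

sublocale product: product_sigma_finite "\<lambda>_. M"
  by unfold_locales

lemma sets_PiM_M [measurable_cong]: "sets (PiM J (\<lambda>_. M)) = sets (PiM J (\<lambda>_. borel))"
  by (intro sets_PiM_cong) auto

lemma space_PiM_M: "space (PiM J (\<lambda>_. M)) = PiE J (\<lambda>_. UNIV)"
  by (simp add: space_PiM)

lemma Min_ccdf_measurable [measurable]:
  assumes "finite J" "J \<noteq> {}"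
  shows "(\<lambda>v. Min ((\<lambda>i. ccdf M (v i)) ` J)) \<in> borel_measurable (PiM J (\<lambda>_. borel))"
  using assms by (intro borel_measurable_Min) measurable

lemma distr_Min_ccdf:
  assumes J: "finite J" "J \<noteq> {}"
  shows "distr (PiM J (\<lambda>_. M)) borel (\<lambda>v. Min ((\<lambda>i. ccdf M (v i)) ` J)) = min_uniform (card J)"
proof (rule measure_eqI_lessThan)
  have [measurable]: "(\<lambda>v. Min ((\<lambda>i. ccdf M (v i)) ` J)) \<in> borel_measurable (PiM J (\<lambda>_. M))"
    using Min_ccdf_measurable[OF J] by (simp cong: measurable_cong_sets add: sets_PiM_M)
  fix x
  let ?D = "distr (PiM J (\<lambda>_. M)) borel (\<lambda>v. Min ((\<lambda>i. ccdf M (v i)) ` J))"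
  have gt: "x < Min ((\<lambda>i. ccdf M (v i)) ` J) \<longleftrightarrow> (\<forall>i\<in>J. x < ccdf M (v i))" for v
    using J by simp
  have "emeasure ?D {x<..} = emeasure (PiM J (\<lambda>_. M)) (PiE J (\<lambda>_. {y. x < ccdf M y}))"
    by (subst emeasure_distr)
      (auto simp: space_PiM_M PiE_iff gt simp del: Min_gr_iff
        intro!: arg_cong[of _ _ "emeasure (PiM J (\<lambda>_. M))"])
  also have "\<dots> = ennreal (1 - max 0 (min 1 x)) ^ card J"
    using J by (subst product.emeasure_PiM) (auto simp: emeasure_ccdf_gt)
  finally have eq: "emeasure ?D {x<..} = ennreal (1 - max 0 (min 1 x)) ^ card J" .
  show "emeasure ?D {x<..} = emeasure (min_uniform (card J)) {x<..}"
    unfolding eq using J by (simp add: emeasure_min_uniform card_gt_0_iff)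
  show "emeasure ?D {x<..} < \<infinity>" unfolding eq by (simp add: ennreal_power)
qed simp_all

lemma nn_integral_Min_ccdf:
  assumes J: "finite J" "J \<noteq> {}" and [measurable]: "f \<in> borel_measurable borel"
  shows "(\<integral>\<^sup>+v. f (Min ((\<lambda>i. ccdf M (v i)) ` J)) \<partial>PiM J (\<lambda>_. M)) = (\<integral>\<^sup>+u. f u \<partial>min_uniform (card J))"
proof -
  have [measurable]: "(\<lambda>v. Min ((\<lambda>i. ccdf M (v i)) ` J)) \<in> borel_measurable (PiM J (\<lambda>_. M))"
    using Min_ccdf_measurable[OF J] by (simp cong: measurable_cong_sets add: sets_PiM_M)
  show ?thesis unfolding distr_Min_ccdf[OF J, symmetric] by (subst nn_integral_distr) auto
qed

end

lemma nn_integral_min_uniform_powr: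
  assumes "0 < a" "0 < k"
  shows "(\<integral>\<^sup>+u. ennreal (u powr (a - 1)) \<partial>min_uniform k)
    = ennreal (Gamma a * Gamma (real k + 1) / Gamma (a + real k))"
proof -
  have "(\<integral>\<^sup>+u. ennreal (u powr (a - 1)) \<partial>min_uniform k)
      = (\<integral>\<^sup>+u. ennreal (indicator {0..1} u * (real k * (u powr (a - 1) * (1 - u) powr (real k - 1)))) \<partial>lborel)"
    unfolding min_uniform_def
  proof (subst nn_integral_density, goal_cases)
    case 3
    show ?case
    \<comment> \<open>At u = 1 and k = 1 the two powers differ, \<open>0 ^ 0\<close> being 1 and
      \<open>0 powr 0\<close> being 0, so this point is discarded as a null set.\<close>
    proof (rule nn_integral_cong_AE, rule AE_mp[OF AE_lborel_singleton[of 1]], rule AE_I2, intro impI)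
      fix u :: real assume u: "u \<noteq> 1"
      show "indicator {0..1} u * ennreal (real k * (1 - u) ^ (k - 1)) * ennreal (u powr (a - 1))
        = ennreal (indicator {0..1} u * (real k * (u powr (a - 1) * (1 - u) powr (real k - 1))))"
      proof (cases "u \<in> {0..1}")
        case True
        with u have "u < 1" by auto
        hence "(1 - u) powr (real k - 1) = (1 - u) ^ (k - 1)"
          using assms by (simp add: powr_realpow[symmetric] of_nat_diff)
        thus ?thesis using True by (simp add: ennreal_mult[symmetric] mult_ac)
      qed simp
    qed
  qed auto
  also have "\<dots> = ennreal (real k * Beta a (real k))"
    using assms by (intro nn_integral_has_integral_lebesgue has_integral_mult_right has_integral_Beta_real) auto
  also have "real k \<notin> \<int>\<^sub>\<le>\<^sub>0" using nonpos_Ints_nonpos[of "real k"] assms by auto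
  hence "real k * Beta a (real k) = Gamma a * Gamma (real k + 1) / Gamma (a + real k)"
    using Gamma_plus1[of "real k"] by (simp add: Beta_def)
  finally show ?thesis .
qed

subsection \<open>Truthful payments of one bidder\<close>

text \<open>Incentive compatibility makes the utility grow at rate at least \<open>x z\<close>; summing over a fine
  grid bounds the utility below by the integral of the allocation.\<close>
lemma utility_ge_integral:
  fixes x p :: "real \<Rightarrow> real"
  assumes ic: "\<And>a b. 0 \<le> a \<Longrightarrow> 0 \<le> b \<Longrightarrow> a * x b - p b \<le> a * x a - p a"
    and ir: "0 \<le> - p 0" and v: "0 \<le> v"
  shows allocation_mono: "\<And>a b. 0 \<le> a \<Longrightarrow> a \<le> b \<Longrightarrow> x a \<le> x b"
    and "integral {0..v} x \<le> v * x v - p v"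
proof -
  show mono: "x a \<le> x b" if "0 \<le> a" "a \<le> b" for a b
  proof (cases "a = b")
    case False
    have "0 \<le> (b - a) * (x b - x a)" using ic[of a b] ic[of b a] that by (simp add: algebra_simps)
    thus ?thesis using False that by (simp add: zero_le_mult_iff)
  qed simp
  define U where "U z = z * x z - p z" for z
  have int: "x integrable_on {a..b}" if "0 \<le> a" for a b
    using that by (intro integrable_on_mono_on) (auto simp: mono_on_def intro: mono)
  have step: "integral {a..b} x \<le> U b - U a + (b - a) * (x b - x a)" if "0 \<le> a" "a \<le> b" for a b
  proof -
    have "integral {a..b} x \<le> integral {a..b} (\<lambda>_. x b)"
      using that by (intro integral_le int) (auto intro: mono)
    also have "\<dots> = (b - a) * x b" using that by simp
    also have "\<dots> \<le> U b - U a + (b - a) * (x b - x a)"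
      using ic[of b a] that by (simp add: U_def algebra_simps)
    finally show ?thesis .
  qed
  \<comment> \<open>On a grid of n equal cells the errors (b - a) (x b - x a) from
    \<open>step\<close> telescope to v / n times x v - x 0.\<close>
  have approx: "integral {0..v} x \<le> U v + v / real n * (x v - x 0)" if n: "0 < n" for n :: nat
  proof -
    define z where "z k = real k * (v / n)" for k
    have z: "0 \<le> z k" "z k \<le> z (Suc k)" "z (Suc k) - z k = v / n" for k
      using v n by (auto simp: z_def field_simps)
    have "integral {0..z k} x \<le> U (z k) - U 0 + v / n * (x (z k) - x 0)" for k
    proof (induction k)
      case 0
      thus ?case by (simp add: z_def)
    next
      case (Suc k)
      have "integral {0..z (Suc k)} x = integral {0..z k} x + integral {z k..z (Suc k)} x"
        using z by (intro Henstock_Kurzweil_Integration.integral_combine[symmetric] int) auto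
      also have "\<dots> \<le> (U (z k) - U 0 + v / n * (x (z k) - x 0))
          + (U (z (Suc k)) - U (z k) + (z (Suc k) - z k) * (x (z (Suc k)) - x (z k)))"
        using z by (intro add_mono Suc.IH step)
      also have "\<dots> = U (z (Suc k)) - U 0 + v / n * (x (z (Suc k)) - x 0)"
        unfolding z(3) by (simp add: algebra_simps)
      finally show ?case .
    qed
    from this[of n] n have "integral {0..v} x \<le> U v - U 0 + v / n * (x v - x 0)"
      by (simp add: z_def)
    thus ?thesis using ir by (simp add: U_def)
  qed
  have "(\<lambda>n. U v + v / real n * (x v - x 0)) \<longlonglongrightarrow> U v + 0 * (x v - x 0)"
    by (intro tendsto_intros lim_const_over_n)
  hence "integral {0..v} x \<le> U v + 0 * (x v - x 0)"
    by (rule tendsto_lowerbound) (use approx in \<open>auto simp: eventually_sequentially intro!: exI[of _ 1]\<close>)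
  thus "integral {0..v} x \<le> v * x v - p v" by (simp add: U_def)
qed

text \<open>The payment of type \<open>v\<close> is at most $\int_0^v (x(v) - x(z))\,dz$, which is written here as
  the average over \<open>y\<close> of the prices posted by the threshold rules \<open>y < x v\<close>.\<close>
lemma payment_le_posted_prices:
  fixes x p :: "real \<Rightarrow> real"
  assumes ic: "\<And>a b. 0 \<le> a \<Longrightarrow> 0 \<le> b \<Longrightarrow> a * x b - p b \<le> a * x a - p a"
    and ir: "0 \<le> - p 0" and v: "0 \<le> v" and [measurable]: "x \<in> borel_measurable borel"
    and x01: "\<And>z. 0 \<le> z \<Longrightarrow> 0 \<le> x z \<and> x z \<le> 1"
  shows "ennreal (p v) \<le> (\<integral>\<^sup>+y. indicator {0..1} y * indicator {y<..} (x v)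
      * emeasure lborel {z. 0 \<le> z \<and> x z \<le> y} \<partial>lborel)"
proof -
  have mono: "x a \<le> x b" if "0 \<le> a" "a \<le> b" for a b
    using allocation_mono[OF ic ir v] that by blast
  have int: "x integrable_on {0..v}"
    by (intro integrable_on_mono_on) (auto simp: mono_on_def intro: mono)
  have "((\<lambda>z. x v - x z) has_integral (v * x v - integral {0..v} x)) {0..v}"
    using has_integral_diff[OF has_integral_const_real[of "x v" 0 v] integrable_integral[OF int]] v by simp
  hence "(\<integral>\<^sup>+z. ennreal (indicator {0..v} z * (x v - x z)) \<partial>lborel) = ennreal (v * x v - integral {0..v} x)"
    using mono by (intro nn_integral_has_integral_lebesgue) auto
  moreover have "p v \<le> v * x v - integral {0..v} x"
    using utility_ge_integral(2)[OF ic ir v] by simp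
  ultimately have "ennreal (p v) \<le> (\<integral>\<^sup>+z. ennreal (indicator {0..v} z * (x v - x z)) \<partial>lborel)"
    by (simp add: ennreal_leI)
  also have "\<dots> \<le> (\<integral>\<^sup>+z. \<integral>\<^sup>+y. indicator {0..1} y * indicator {y<..} (x v)
      * indicator {z. 0 \<le> z \<and> x z \<le> y} z \<partial>lborel \<partial>lborel)"
  proof (rule nn_integral_mono)
    fix z
    show "ennreal (indicator {0..v} z * (x v - x z)) \<le> (\<integral>\<^sup>+y. indicator {0..1} y * indicator {y<..} (x v)
      * indicator {z. 0 \<le> z \<and> x z \<le> y} z \<partial>lborel)"
    proof (cases "z \<in> {0..v}")
      case True
      hence "ennreal (indicator {0..v} z * (x v - x z)) = emeasure lborel {x z..<x v}"
        using mono by simp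
      also have "\<dots> = (\<integral>\<^sup>+y. indicator {x z..<x v} y \<partial>lborel)" by simp
      also have "\<dots> \<le> (\<integral>\<^sup>+y. indicator {0..1} y * indicator {y<..} (x v)
        * indicator {z. 0 \<le> z \<and> x z \<le> y} z \<partial>lborel)"
        using True x01[of z] x01[of v] v by (intro nn_integral_mono) (auto simp: indicator_def)
      finally show ?thesis .
    qed simp
  qed
  also have "\<dots> = (\<integral>\<^sup>+y. \<integral>\<^sup>+z. indicator {0..1} y * indicator {y<..} (x v)
      * indicator {z. 0 \<le> z \<and> x z \<le> y} z \<partial>lborel \<partial>lborel)"
    by (rule lborel_pair.Fubini') (simp add: indicator_def, measurable)
  also have "\<dots> = (\<integral>\<^sup>+y. indicator {0..1} y * indicator {y<..} (x v)
      * emeasure lborel {z. 0 \<le> z \<and> x z \<le> y} \<partial>lborel)"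
    by (intro nn_integral_cong) (subst nn_integral_cmult, auto)
  finally show ?thesis .
qed

text \<open>Every threshold y turns the allocation into a posted price: the types with y < x v form
  an up-set, and \<open>posted\<close> bounds the revenue of selling to it at its infimum. Averaging
  over y in [0, 1] reassembles x, and A enters once because the thresholds have total mass 1. The
  sets S cover both cases, infimum attained or not.\<close>

lemma (in real_distribution) expected_payment_le:
  fixes x p :: "real \<Rightarrow> real" and \<phi> :: "real \<Rightarrow> ennreal" and A :: ennreal
  assumes ic: "\<And>a b. 0 \<le> a \<Longrightarrow> 0 \<le> b \<Longrightarrow> a * x b - p b \<le> a * x a - p a"
    and ir: "0 \<le> - p 0"
    and x01: "\<And>z. 0 \<le> z \<Longrightarrow> 0 \<le> x z \<and> x z \<le> 1"
    and [measurable]: "x \<in> borel_measurable borel" "p \<in> borel_measurable borel" "\<phi> \<in> borel_measurable borel"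
    and nonneg: "AE v in M. 0 \<le> v"
    and posted: "\<And>S \<tau>. S \<in> sets borel \<Longrightarrow> S \<subseteq> {\<tau>..} \<Longrightarrow> {\<tau><..} \<subseteq> S \<Longrightarrow> 0 \<le> \<tau> \<Longrightarrow>
      ennreal \<tau> * emeasure M S \<le> A + (\<integral>\<^sup>+v. \<phi> v * indicator S v \<partial>M)"
  shows "(\<integral>\<^sup>+v. ennreal (p v) \<partial>M) \<le> A + (\<integral>\<^sup>+v. \<phi> v * ennreal (x v) \<partial>M)"
proof -
  have [measurable]: "x \<in> borel_measurable M" "p \<in> borel_measurable M" "\<phi> \<in> borel_measurable M"
    by (simp_all cong: measurable_cong_sets)
  have mono: "x a \<le> x b" if "0 \<le> a" "a \<le> b" for a b
    using allocation_mono[OF ic ir order.refl] that by blast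
  define L where "L y = emeasure lborel {z. 0 \<le> z \<and> x z \<le> y}" for y
  have "L = (\<lambda>y. \<integral>\<^sup>+z. indicator {z. 0 \<le> z \<and> x z \<le> y} z \<partial>lborel)"
    by (auto simp: L_def fun_eq_iff)
  hence [measurable]: "L \<in> borel_measurable borel" by (simp add: indicator_def)
  have key: "L y * emeasure M {v. 0 \<le> v \<and> y < x v} \<le> A + (\<integral>\<^sup>+v. \<phi> v * indicator {v. 0 \<le> v \<and> y < x v} v \<partial>M)" for y
  proof (cases "{v. 0 \<le> v \<and> y < x v} = {}")
    case False
    define S where "S = {v. 0 \<le> v \<and> y < x v}"
    define \<tau> where "\<tau> = Inf S"
    have S: "S \<noteq> {}" "bdd_below S" "S \<in> sets borel"
      using False by (auto simp: S_def intro!: bdd_belowI[of _ 0])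
    have \<tau>0: "0 \<le> \<tau>" unfolding \<tau>_def using S by (intro cInf_greatest) (auto simp: S_def)
    have up: "w \<in> S" if "v \<in> S" "v \<le> w" for v w
      using that mono[of v w] by (auto simp: S_def)
    have sub: "{\<tau><..} \<subseteq> S"
    proof
      fix w assume "w \<in> {\<tau><..}"
      then obtain v where "v \<in> S" "v < w" using S by (auto simp: \<tau>_def cInf_less_iff)
      thus "w \<in> S" using up by simp
    qed
    have sup: "S \<subseteq> {\<tau>..}" unfolding \<tau>_def using S by (auto intro: cInf_lower)
    have "{z. 0 \<le> z \<and> x z \<le> y} \<subseteq> {0..\<tau>}"
    proof
      fix z assume z: "z \<in> {z. 0 \<le> z \<and> x z \<le> y}"
      hence "z \<notin> S" by (auto simp: S_def)
      hence "z \<notin> {\<tau><..}" using sub by blast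
      with z show "z \<in> {0..\<tau>}" by simp
    qed
    hence "L y \<le> emeasure lborel {0..\<tau>}" unfolding L_def by (intro emeasure_mono) auto
    also have "\<dots> = ennreal \<tau>" using \<tau>0 by simp
    finally have "L y * emeasure M S \<le> ennreal \<tau> * emeasure M S" by (intro mult_right_mono) auto
    also have "\<dots> \<le> A + (\<integral>\<^sup>+v. \<phi> v * indicator S v \<partial>M)"
      by (rule posted) (use S sub sup \<tau>0 in auto)
    finally show ?thesis unfolding S_def .
  next
    case True
    \<comment> \<open>L y is infinite here, but it multiplies the measure of the empty set, and the
      product is 0 in \<open>ennreal\<close>.\<close>
    show ?thesis unfolding True by simp
  qed
  have "(\<integral>\<^sup>+v. ennreal (p v) \<partial>M)
      \<le> (\<integral>\<^sup>+v. \<integral>\<^sup>+y. indicator {0..1} y * indicator {v. 0 \<le> v \<and> y < x v} v * L y \<partial>lborel \<partial>M)"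
  proof (rule nn_integral_mono_AE, rule AE_mp[OF nonneg], rule AE_I2, intro impI)
    fix v :: real assume "0 \<le> v"
    thus "ennreal (p v) \<le> (\<integral>\<^sup>+y. indicator {0..1} y * indicator {v. 0 \<le> v \<and> y < x v} v * L y \<partial>lborel)"
      using payment_le_posted_prices[of x p v] ic ir x01
      by (simp add: indicator_def L_def)
  qed
  also have "\<dots> = (\<integral>\<^sup>+y. \<integral>\<^sup>+v. indicator {0..1} y * indicator {v. 0 \<le> v \<and> y < x v} v * L y \<partial>M \<partial>lborel)"
  proof (rule pair_sigma_finite.Fubini')
    show "pair_sigma_finite (lborel :: real measure) M" by unfold_locales
  qed (simp add: indicator_def, measurable)
  also have "\<dots> = (\<integral>\<^sup>+y. indicator {0..1} y * (L y * emeasure M {v. 0 \<le> v \<and> y < x v}) \<partial>lborel)"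
  proof (rule nn_integral_cong)
    fix y :: real
    have "(\<integral>\<^sup>+v. indicator {0..1} y * indicator {v. 0 \<le> v \<and> y < x v} v * L y \<partial>M)
        = (\<integral>\<^sup>+v. (indicator {0..1} y * L y) * indicator {v. 0 \<le> v \<and> y < x v} v \<partial>M)"
      by (simp add: mult_ac)
    also have "\<dots> = indicator {0..1} y * L y * emeasure M {v. 0 \<le> v \<and> y < x v}"
      by (subst nn_integral_cmult_indicator) auto
    finally show "(\<integral>\<^sup>+v. indicator {0..1} y * indicator {v. 0 \<le> v \<and> y < x v} v * L y \<partial>M)
        = indicator {0..1} y * (L y * emeasure M {v. 0 \<le> v \<and> y < x v})" by (simp add: mult_ac)
  qed
  also have "\<dots> \<le> (\<integral>\<^sup>+y. indicator {0..1} y * (A + (\<integral>\<^sup>+v. \<phi> v * indicator {v. 0 \<le> v \<and> y < x v} v \<partial>M)) \<partial>lborel)"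
    using key by (intro nn_integral_mono mult_left_mono) auto
  also have "\<dots> = (\<integral>\<^sup>+y. A * indicator {0..1} y
      + (\<integral>\<^sup>+v. indicator {0..1} y * (\<phi> v * indicator {v. 0 \<le> v \<and> y < x v} v) \<partial>M) \<partial>lborel)"
    by (intro nn_integral_cong) (auto simp: indicator_def)
  also have "\<dots> = A * emeasure lborel {0..1::real}
      + (\<integral>\<^sup>+y. \<integral>\<^sup>+v. indicator {0..1} y * (\<phi> v * indicator {v. 0 \<le> v \<and> y < x v} v) \<partial>M \<partial>lborel)"
  proof (subst nn_integral_add, goal_cases)
    case 2
    show ?case by (simp add: indicator_def)
  qed (simp_all add: nn_integral_cmult_indicator)
  also have "(\<integral>\<^sup>+y. \<integral>\<^sup>+v. indicator {0..1} y * (\<phi> v * indicator {v. 0 \<le> v \<and> y < x v} v) \<partial>M \<partial>lborel)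
      = (\<integral>\<^sup>+v. \<integral>\<^sup>+y. indicator {0..1} y * (\<phi> v * indicator {v. 0 \<le> v \<and> y < x v} v) \<partial>lborel \<partial>M)"
  proof (rule pair_sigma_finite.Fubini'[symmetric])
    show "pair_sigma_finite (lborel :: real measure) M" by unfold_locales
  qed (simp add: indicator_def, measurable)
  also have "\<dots> \<le> (\<integral>\<^sup>+v. \<phi> v * ennreal (x v) \<partial>M)"
  proof (rule nn_integral_mono)
    fix v
    have "(\<integral>\<^sup>+y. indicator {0..1} y * (\<phi> v * indicator {v. 0 \<le> v \<and> y < x v} v) \<partial>lborel)
      \<le> (\<integral>\<^sup>+y. \<phi> v * indicator {0..<x v} y \<partial>lborel)"
      by (intro nn_integral_mono) (auto simp: indicator_def)
    also have "\<dots> = \<phi> v * ennreal (x v)"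
      by (cases "0 \<le> x v") (simp_all add: nn_integral_cmult_indicator ennreal_neg)
    finally show "(\<integral>\<^sup>+y. indicator {0..1} y * (\<phi> v * indicator {v. 0 \<le> v \<and> y < x v} v) \<partial>lborel)
      \<le> \<phi> v * ennreal (x v)" .
  qed
  finally show ?thesis by simp
qed

subsection \<open>Upper bound on the optimal revenue\<close>

text \<open>For $\lambda < 1$ this is $(1 - \lambda)\, E[m^{-\lambda}]$, where \<open>m\<close> is the minimum of
  \<open>n\<close> uniform variables. At $\lambda = 1$, where that expectation is infinite, the value is \<open>n\<close>; the
  virtual value of a bidder then has an atom at infinity, represented by the constant \<open>A\<close> below.\<close>
definition min_moment :: "real \<Rightarrow> nat \<Rightarrow> real" where
  "min_moment lam n = Gamma (2 - lam) * Gamma (real n + 1) / Gamma (real n + 1 - lam)"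

lemma min_moment_pos: "0 < lam \<Longrightarrow> lam \<le> 1 \<Longrightarrow> 0 < n \<Longrightarrow> 0 < min_moment lam n"
  unfolding min_moment_def by (intro divide_pos_pos mult_pos_pos Gamma_real_pos) auto

lemma ennreal_sum_le: "ennreal (\<Sum>i\<in>I. f i) \<le> (\<Sum>i\<in>I. ennreal (f i))"
proof -
  have "ennreal (\<Sum>i\<in>I. f i) \<le> ennreal (\<Sum>i\<in>I. max 0 (f i))"
    by (intro ennreal_leI sum_mono) simp
  also have "\<dots> = (\<Sum>i\<in>I. ennreal (f i))"
    by (subst sum_ennreal[symmetric]) (auto simp: ennreal_max_0)
  finally show ?thesis .
qed

context atomless_distribution
begin

lemma nn_integral_ccdf:
  assumes [measurable]: "f \<in> borel_measurable borel"
  shows "(\<integral>\<^sup>+v. f (ccdf M v) \<partial>M) = (\<integral>\<^sup>+u. indicator {0..1} u * f u \<partial>lborel)"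
proof -
  have "(\<integral>\<^sup>+v. f (ccdf M v) \<partial>M) = (\<integral>\<^sup>+u. f u \<partial>min_uniform 1)"
    unfolding distr_ccdf[symmetric] by (subst nn_integral_distr) auto
  thus ?thesis unfolding min_uniform_def by (subst (asm) nn_integral_density) auto
qed

text \<open>The integrand is the derivative of a u^(1 - lam) at the quantile u. At u = q this is the
  revenue of the price a q^(-lam), which sells with probability q under the linear value function;
  for lam < 1 it tends to 0 with u, so the integral recovers all of it.\<close>

lemma nn_integral_ccdf_powr:
  assumes "lam < 1" "0 \<le> a" "0 \<le> q" "q \<le> 1"
  shows "(\<integral>\<^sup>+v. ennreal ((1 - lam) * a * ccdf M v powr (- lam)) * indicator {v. ccdf M v < q} v \<partial>M)
    = ennreal (a * q powr (1 - lam))"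
proof -
  have "(\<integral>\<^sup>+v. ennreal ((1 - lam) * a * ccdf M v powr (- lam)) * indicator {v. ccdf M v < q} v \<partial>M)
      = (\<integral>\<^sup>+v. ennreal ((1 - lam) * a * ccdf M v powr (- lam)) * indicator {..<q} (ccdf M v) \<partial>M)"
    by (intro nn_integral_cong) (simp add: indicator_def)
  also have "\<dots> = (\<integral>\<^sup>+u. indicator {0..1} u * (ennreal ((1 - lam) * a * u powr (- lam)) * indicator {..<q} u) \<partial>lborel)"
    by (rule nn_integral_ccdf) simp
  also have "\<dots> = (\<integral>\<^sup>+u. ennreal (indicator {0..q} u * ((1 - lam) * a * u powr (- lam))) \<partial>lborel)"
    by (rule nn_integral_cong_AE, rule AE_mp[OF AE_lborel_singleton[of q]], rule AE_I2)
      (use assms in \<open>auto simp: indicator_def\<close>)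
  also have "\<dots> = ennreal ((1 - lam) * a * (q powr (- lam + 1) / (- lam + 1)))"
    using assms by (intro nn_integral_has_integral_lebesgue has_integral_mult_right has_integral_powr_from_0) auto
  also have "(1 - lam) * a * (q powr (- lam + 1) / (- lam + 1)) = a * q powr (1 - lam)"
    using assms by simp
  finally show ?thesis .
qed

lemma emeasure_upset:
  assumes "S \<in> sets borel" "S \<subseteq> {\<tau>..}" "{\<tau><..} \<subseteq> S"
  shows "emeasure M S = ennreal (ccdf M \<tau>)"
proof (rule antisym)
  have "emeasure M S \<le> emeasure M {\<tau>..}" using assms by (intro emeasure_mono) auto
  thus "emeasure M S \<le> ennreal (ccdf M \<tau>)" by (simp add: ccdf_eq_Ici emeasure_eq_measure)
  have "emeasure M {\<tau><..} \<le> emeasure M S" using assms by (intro emeasure_mono) auto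
  thus "ennreal (ccdf M \<tau>) \<le> emeasure M S" by (simp add: ccdf_eq emeasure_eq_measure)
qed

text \<open>Conditionally on the rivals, the payment of each bidder is charged to the virtual value
  \<Phi> of the linear value function. As \<Phi> does not increase with the quantile and the item is
  sold at most once, the total is at most \<Phi> at the smallest quantile, plus n times the constant
  A.\<close>

lemma Myerson_le:
  assumes lam: "0 < lam" "lam \<le> 1" and n: "0 < n" and ab: "0 \<le> a" "0 \<le> b"
    and nonneg: "AE v in M. 0 \<le> v"
    and bound: "\<And>z. 0 \<le> z \<Longrightarrow> 0 < ccdf M z \<Longrightarrow> z \<le> a * ccdf M z powr (- lam) + b"
  shows "Myerson M n \<le> ereal (a * min_moment lam n + b)"
proof -
  \<comment> \<open>\<Phi> is the derivative of the revenue curve a u^(1 - lam) + b u. For lam = 1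
    that curve jumps from 0 to a at u = 0, and A records the jump.\<close>
  define \<Phi> where "\<Phi> u = ennreal ((1 - lam) * a * u powr (- lam) + b)" for u
  define A where "A = (if lam = 1 then ennreal a else 0)"
  have [measurable]: "\<Phi> \<in> borel_measurable borel" unfolding \<Phi>_def by simp
  have posted: "ennreal \<tau> * emeasure M S \<le> A + (\<integral>\<^sup>+v. \<Phi> (ccdf M v) * indicator S v \<partial>M)"
    if S: "S \<in> sets borel" "S \<subseteq> {\<tau>..}" "{\<tau><..} \<subseteq> S" and \<tau>: "0 \<le> \<tau>" for S \<tau>
  proof (cases "ccdf M \<tau> = 0")
    case False
    define q where "q = ccdf M \<tau>"
    have q: "0 < q" "q \<le> 1" using False ccdf_nonneg[of \<tau>] ccdf_le_1 by (auto simp: q_def)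
    have [measurable]: "S \<in> sets M" using S by simp
    have "\<tau> * q \<le> (a * q powr (- lam) + b) * q"
      using bound[of \<tau>] \<tau> q by (intro mult_right_mono) (auto simp: q_def)
    also have "\<dots> = a * q powr (1 - lam) + b * q"
      using q by (simp add: powr_diff powr_minus field_simps)
    finally have "ennreal \<tau> * emeasure M S \<le> ennreal (a * q powr (1 - lam)) + ennreal (b * q)"
      using emeasure_upset[OF S] q ab \<tau>
      by (simp add: q_def[symmetric] ennreal_mult[symmetric] ennreal_plus[symmetric] ennreal_leI del: ennreal_plus)
    also have "ennreal (b * q) = (\<integral>\<^sup>+v. ennreal b * indicator S v \<partial>M)"
      using emeasure_upset[OF S] q ab S(1)
      by (subst nn_integral_cmult_indicator) (simp_all add: q_def[symmetric] ennreal_mult)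
    also have "ennreal (a * q powr (1 - lam))
        \<le> A + (\<integral>\<^sup>+v. ennreal ((1 - lam) * a * ccdf M v powr (- lam)) * indicator S v \<partial>M)"
    proof (cases "lam = 1")
      case True
      thus ?thesis using q by (simp add: A_def)
    next
      case False
      have "{v. ccdf M v < q} \<subseteq> {\<tau><..}"
      proof
        fix v assume "v \<in> {v. ccdf M v < q}"
        thus "v \<in> {\<tau><..}" using ccdf_antimono[of v \<tau>] by (cases "v \<le> \<tau>") (auto simp: q_def)
      qed
      with S have sub: "{v. ccdf M v < q} \<subseteq> S" by blast
      have "ennreal (a * q powr (1 - lam))
        = (\<integral>\<^sup>+v. ennreal ((1 - lam) * a * ccdf M v powr (- lam)) * indicator {v. ccdf M v < q} v \<partial>M)"
        using lam False ab q by (intro nn_integral_ccdf_powr[symmetric]) auto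
      also have "\<dots> \<le> (\<integral>\<^sup>+v. ennreal ((1 - lam) * a * ccdf M v powr (- lam)) * indicator S v \<partial>M)"
        using sub by (intro nn_integral_mono mult_left_mono) (auto simp: indicator_def)
      finally show ?thesis using False by (simp add: A_def)
    qed
    also have "A + (\<integral>\<^sup>+v. ennreal ((1 - lam) * a * ccdf M v powr (- lam)) * indicator S v \<partial>M)
        + (\<integral>\<^sup>+v. ennreal b * indicator S v \<partial>M) = A + (\<integral>\<^sup>+v. \<Phi> (ccdf M v) * indicator S v \<partial>M)"
      unfolding add.assoc
    proof (subst nn_integral_add[symmetric], goal_cases)
      case 3
      show ?case using lam ab
        by (intro arg_cong[of _ _ "\<lambda>x. A + x"] nn_integral_cong)
          (auto simp: \<Phi>_def indicator_def ennreal_plus[symmetric] simp del: ennreal_plus)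
    qed auto
    finally show ?thesis by (auto simp: add_right_mono)
  qed (use emeasure_upset[OF S] in simp)
  let ?P = "PiM {..<n} (\<lambda>_. M)"
  interpret P: prob_space ?P by (intro prob_space_PiM) unfold_locales
  have prod_nonneg: "AE v in PiM J (\<lambda>_. M). \<forall>i\<in>J. 0 \<le> v i" if "finite J" for J :: "nat set"
    using that nonneg by (intro AE_finite_allI AE_PiM_component[of J "\<lambda>_. M"] prob_space_axioms) auto
  have prod_pos: "AE v in ?P. \<forall>i\<in>{..<n}. 0 < ccdf M (v i)"
    using AE_ccdf_pos by (intro AE_finite_allI AE_PiM_component[of "{..<n}" "\<lambda>_. M"] prob_space_axioms) auto
  have revenue: "(\<integral>v. (\<Sum>i<n. p v i) \<partial>?P) \<le> a * min_moment lam n + b"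
    if auction: "truthful_auction n x p" and int: "integrable ?P (\<lambda>v. \<Sum>i<n. p v i)" for x p
  proof -
    have [measurable]: "(\<lambda>v. x v i) \<in> borel_measurable ?P" "(\<lambda>v. p v i) \<in> borel_measurable ?P" if "i < n" for i
      using auction that unfolding truthful_auction_def by (simp_all cong: measurable_cong_sets add: sets_PiM_M)
    have x0: "0 \<le> x v i" if "v \<in> profiles n" "i < n" for v i
      using auction that unfolding truthful_auction_def by blast
    have x1: "(\<Sum>i<n. x v i) \<le> 1" if "v \<in> profiles n" for v
      using auction that unfolding truthful_auction_def by blast
    have xle: "x v i \<le> 1" if "v \<in> profiles n" "i < n" for v i
    proof -
      have "x v i \<le> (\<Sum>i<n. x v i)" using that x0 by (intro member_le_sum) auto
      with x1[OF that(1)] show ?thesis by simp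
    qed
    have ic: "v i * x (v(i := b)) i - p (v(i := b)) i \<le> v i * x v i - p v i"
      if "v \<in> profiles n" "i < n" "0 \<le> b" for v i b
      using auction that unfolding truthful_auction_def by blast
    have ir: "0 \<le> v i * x v i - p v i" if "v \<in> profiles n" "i < n" for v i
      using auction that unfolding truthful_auction_def by blast
    have single: "(\<integral>\<^sup>+v. ennreal (p v i) \<partial>?P) \<le> A + (\<integral>\<^sup>+v. \<Phi> (ccdf M (v i)) * ennreal (x v i) \<partial>?P)"
      if i: "i < n" for i
    proof -
      \<comment> \<open>Fixing the rivals leaves a one-bidder rule; \<open>prod_nonneg\<close>
        places the profile where the incentive conditions are stated.\<close>
      define J where "J = {..<n} - {i}"
      have J: "{..<n} = insert i J" "finite J" "i \<notin> J" using i by (auto simp: J_def)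
      interpret J: prob_space "PiM J (\<lambda>_. M)" by (intro prob_space_PiM) unfold_locales
      have mi [measurable]: "(\<lambda>v. x v i) \<in> borel_measurable (PiM (insert i J) (\<lambda>_. M))"
        "(\<lambda>v. p v i) \<in> borel_measurable (PiM (insert i J) (\<lambda>_. M))"
        using i by (simp_all flip: J(1))
      have "(\<integral>\<^sup>+v. ennreal (p v i) \<partial>?P) = (\<integral>\<^sup>+v. \<integral>\<^sup>+z. ennreal (p (v(i := z)) i) \<partial>M \<partial>PiM J (\<lambda>_. M))"
        unfolding J(1) using J by (intro product.product_nn_integral_insert) auto
      also have "\<dots> \<le> (\<integral>\<^sup>+v. A + (\<integral>\<^sup>+z. \<Phi> (ccdf M z) * ennreal (x (v(i := z)) i) \<partial>M) \<partial>PiM J (\<lambda>_. M))"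
      proof (rule nn_integral_mono_AE, rule AE_mp[OF prod_nonneg[OF J(2)]], rule AE_I2, intro impI)
        fix v assume v: "v \<in> space (PiM J (\<lambda>_. M))" "\<forall>j\<in>J. 0 \<le> v j"
        have prof: "v(i := z) \<in> profiles n" if "0 \<le> z" for z
          using v that J by (auto simp: profiles_def space_PiM_M PiE_iff extensional_def)
        have upd: "(\<lambda>z. v(i := z)) \<in> M \<rightarrow>\<^sub>M PiM (insert i J) (\<lambda>_. M)"
          using v J by (intro measurable_component_update) auto
        show "(\<integral>\<^sup>+z. ennreal (p (v(i := z)) i) \<partial>M) \<le> A + (\<integral>\<^sup>+z. \<Phi> (ccdf M z) * ennreal (x (v(i := z)) i) \<partial>M)"
        proof (rule expected_payment_le[OF _ _ _ _ _ _ nonneg posted])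
          fix c d :: real assume "0 \<le> c" "0 \<le> d"
          thus "c * x (v(i := d)) i - p (v(i := d)) i \<le> c * x (v(i := c)) i - p (v(i := c)) i"
            using ic[OF prof i, of c d] by simp
        next
          show "0 \<le> - p (v(i := 0)) i" using ir[OF prof[of 0] i] by simp
        next
          fix z :: real assume "0 \<le> z"
          thus "0 \<le> x (v(i := z)) i \<and> x (v(i := z)) i \<le> 1" using x0 xle prof i by blast
        next
          show "(\<lambda>z. x (v(i := z)) i) \<in> borel_measurable borel" "(\<lambda>z. p (v(i := z)) i) \<in> borel_measurable borel"
            using measurable_compose[OF upd mi(1)] measurable_compose[OF upd mi(2)]
            by (simp_all cong: measurable_cong_sets)
        qed auto
      qed
      also have "\<dots> = A + (\<integral>\<^sup>+v. \<integral>\<^sup>+z. \<Phi> (ccdf M z) * ennreal (x (v(i := z)) i) \<partial>M \<partial>PiM J (\<lambda>_. M))"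
      proof -
        have "(\<lambda>(v, z). v(i := z)) \<in> PiM J (\<lambda>_. M) \<Otimes>\<^sub>M M \<rightarrow>\<^sub>M PiM (insert i J) (\<lambda>_. M)"
          by (rule measurable_add_dim)
        from measurable_compose[OF this mi(1)]
        have "(\<lambda>(v, z). x (v(i := z)) i) \<in> borel_measurable (PiM J (\<lambda>_. M) \<Otimes>\<^sub>M M)"
          by (simp add: case_prod_beta)
        hence [measurable]: "(\<lambda>v. \<integral>\<^sup>+z. \<Phi> (ccdf M z) * ennreal (x (v(i := z)) i) \<partial>M)
          \<in> borel_measurable (PiM J (\<lambda>_. M))"
          by (intro borel_measurable_nn_integral) (simp add: case_prod_beta)
        show ?thesis by (subst nn_integral_add) (auto simp: J.emeasure_space_1)
      qed
      also have "(\<integral>\<^sup>+v. \<integral>\<^sup>+z. \<Phi> (ccdf M z) * ennreal (x (v(i := z)) i) \<partial>M \<partial>PiM J (\<lambda>_. M))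
        = (\<integral>\<^sup>+v. \<Phi> (ccdf M (v i)) * ennreal (x v i) \<partial>?P)"
        unfolding J(1) using J by (subst product.product_nn_integral_insert) auto
      finally show ?thesis .
    qed
    have "ennreal (\<integral>v. (\<Sum>i<n. p v i) \<partial>?P) \<le> ennreal (\<integral>v. max 0 (\<Sum>i<n. p v i) \<partial>?P)"
      using int by (intro ennreal_leI integral_mono) auto
    also have "\<dots> = (\<integral>\<^sup>+v. ennreal (max 0 (\<Sum>i<n. p v i)) \<partial>?P)"
      using int by (intro nn_integral_eq_integral[symmetric]) auto
    also have "\<dots> \<le> (\<integral>\<^sup>+v. (\<Sum>i<n. ennreal (p v i)) \<partial>?P)"
      by (intro nn_integral_mono) (simp add: ennreal_max_0 ennreal_sum_le)
    also have "\<dots> = (\<Sum>i<n. \<integral>\<^sup>+v. ennreal (p v i) \<partial>?P)"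
      by (intro nn_integral_sum) auto
    also have "\<dots> \<le> (\<Sum>i<n. A + (\<integral>\<^sup>+v. \<Phi> (ccdf M (v i)) * ennreal (x v i) \<partial>?P))"
      using single by (intro sum_mono) auto
    also have "\<dots> = of_nat n * A + (\<integral>\<^sup>+v. (\<Sum>i<n. \<Phi> (ccdf M (v i)) * ennreal (x v i)) \<partial>?P)"
      by (subst nn_integral_sum) (auto simp: sum.distrib)
    also have "(\<integral>\<^sup>+v. (\<Sum>i<n. \<Phi> (ccdf M (v i)) * ennreal (x v i)) \<partial>?P)
        \<le> (\<integral>\<^sup>+v. \<Phi> (Min ((\<lambda>i. ccdf M (v i)) ` {..<n})) \<partial>?P)"
    proof (rule nn_integral_mono_AE, rule AE_mp[OF prod_nonneg[of "{..<n}"]], simp, rule AE_mp[OF prod_pos], rule AE_I2, intro impI)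
      fix v assume v: "v \<in> space ?P" "\<forall>i\<in>{..<n}. 0 < ccdf M (v i)" "\<forall>i\<in>{..<n}. 0 \<le> v i"
      define m where "m = Min ((\<lambda>i. ccdf M (v i)) ` {..<n})"
      have "m \<in> (\<lambda>i. ccdf M (v i)) ` {..<n}" unfolding m_def using n by (intro Min_in) auto
      hence m0: "0 < m" using v by auto
      have prof: "v \<in> profiles n" using v by (auto simp: profiles_def space_PiM_M PiE_iff)
      have "(\<Sum>i<n. \<Phi> (ccdf M (v i)) * ennreal (x v i)) \<le> (\<Sum>i<n. \<Phi> m * ennreal (x v i))"
      proof (intro sum_mono mult_right_mono)
        fix i assume "i \<in> {..<n}"
        hence "m \<le> ccdf M (v i)" unfolding m_def by (intro Min_le) auto
        thus "\<Phi> (ccdf M (v i)) \<le> \<Phi> m" unfolding \<Phi>_def using lam ab m0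
          by (intro ennreal_leI add_right_mono mult_left_mono powr_mono2') auto
      qed auto
      also have "\<dots> = \<Phi> m * ennreal (\<Sum>i<n. x v i)"
        using x0[OF prof] by (subst sum_ennreal[symmetric]) (simp_all add: sum_distrib_left)
      also have "\<dots> \<le> \<Phi> m * 1"
        using x1[OF prof] by (intro mult_left_mono) (auto simp: ennreal_le_1)
      finally show "(\<Sum>i<n. \<Phi> (ccdf M (v i)) * ennreal (x v i)) \<le> \<Phi> m" by simp
    qed
    also have "\<dots> = (\<integral>\<^sup>+u. \<Phi> u \<partial>min_uniform n)"
      using n by (subst nn_integral_Min_ccdf) auto
    also have "of_nat n * A + (\<integral>\<^sup>+u. \<Phi> u \<partial>min_uniform n) = ennreal (a * min_moment lam n + b)"
    proof -
      have one: "emeasure (min_uniform n) UNIV = 1"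
      proof -
        have "emeasure (min_uniform n) UNIV = (\<integral>\<^sup>+u. 1 \<partial>min_uniform n)"
          by (simp add: min_uniform_def)
        also have "\<dots> = (\<integral>\<^sup>+v. 1 \<partial>?P)"
          using nn_integral_Min_ccdf[of "{..<n}" "\<lambda>_. 1"] n by (simp add: lessThan_empty_iff)
        also have "\<dots> = 1" by (simp add: P.emeasure_space_1)
        finally show ?thesis .
      qed
      have split: "(\<integral>\<^sup>+u. \<Phi> u \<partial>min_uniform n)
          = ennreal ((1 - lam) * a) * (\<integral>\<^sup>+u. ennreal (u powr (- lam)) \<partial>min_uniform n) + ennreal b"
      proof -
        have "(\<integral>\<^sup>+u. \<Phi> u \<partial>min_uniform n)
            = (\<integral>\<^sup>+u. ennreal ((1 - lam) * a) * ennreal (u powr (- lam)) + ennreal b \<partial>min_uniform n)"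
          using lam ab by (intro nn_integral_cong) (simp add: \<Phi>_def ennreal_mult[symmetric])
        also have "\<dots> = ennreal ((1 - lam) * a) * (\<integral>\<^sup>+u. ennreal (u powr (- lam)) \<partial>min_uniform n)
            + ennreal b * emeasure (min_uniform n) (space (min_uniform n))"
          by (subst nn_integral_add) (auto simp: nn_integral_cmult)
        also have "space (min_uniform n) = UNIV" by (simp add: min_uniform_def)
        finally show ?thesis using one by simp
      qed
      show ?thesis
      proof (cases "lam = 1")
        case True
        \<comment> \<open>The n jumps contribute n a, which is a times \<open>min_moment\<close> at
          lam = 1.\<close>
        have "real n \<notin> \<int>\<^sub>\<le>\<^sub>0" using nonpos_Ints_nonpos[of "real n"] n by auto
        hence "min_moment lam n = real n"
          using True n Gamma_plus1[of "real n"] by (simp add: min_moment_def Gamma_eq_zero_iff)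
        thus ?thesis unfolding split A_def using True ab
          by (simp add: ennreal_plus ennreal_mult ennreal_of_nat_eq_real_of_nat mult.commute)
      next
        case False
        hence l1: "0 < 1 - lam" using lam by simp
        have "1 - lam \<notin> \<int>\<^sub>\<le>\<^sub>0" using nonpos_Ints_nonpos[of "1 - lam"] l1 by auto
        hence G2: "Gamma (2 - lam) = (1 - lam) * Gamma (1 - lam)"
          using Gamma_plus1[of "1 - lam"] by simp
        have arg: "1 - lam + real n = real n + 1 - lam" by simp
        have "(1 - lam) * a * (Gamma (1 - lam) * Gamma (real n + 1) / Gamma (1 - lam + real n))
            = a * min_moment lam n"
          unfolding min_moment_def G2 arg by simp
        moreover have "0 \<le> Gamma (1 - lam) * Gamma (real n + 1) / Gamma (1 - lam + real n)"
          using l1 by (intro divide_nonneg_nonneg mult_nonneg_nonneg Gamma_real_nonneg) auto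
        ultimately have "(\<integral>\<^sup>+u. \<Phi> u \<partial>min_uniform n) = ennreal (a * min_moment lam n) + ennreal b"
          unfolding split using l1 ab n nn_integral_min_uniform_powr[of "1 - lam" n]
          by (simp add: ennreal_mult[symmetric])
        thus ?thesis using False ab min_moment_pos[OF lam n] by (simp add: A_def ennreal_plus)
      qed
    qed
    finally have "ennreal (\<integral>v. (\<Sum>i<n. p v i) \<partial>?P) \<le> ennreal (a * min_moment lam n + b)" by (auto simp: add_left_mono)
    moreover have "0 \<le> a * min_moment lam n + b"
      using ab min_moment_pos[OF lam n] by simp
    ultimately show ?thesis by (simp add: ennreal_le_iff)
  qed
  show ?thesis unfolding Myerson_def by (intro SUP_least) (auto intro: revenue)
qed

end

subsection \<open>Regular distributions\<close>

text \<open>A discrete Gronwall inequality: n steps of length D / n give the factor (1 + c D / n)^n.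
  It involves no derivative of h and serves with c = 1 and with c = -1.\<close>

lemma exp_growth:
  fixes h :: "real \<Rightarrow> real"
  assumes D: "0 \<le> D"
    and step: "\<And>a d. 0 \<le> a \<Longrightarrow> 0 \<le> d \<Longrightarrow> a + d \<le> D \<Longrightarrow> (1 + c * d) * h a \<le> h (a + d)"
  shows "exp (c * D) * h 0 \<le> h D"
proof (rule tendsto_upperbound)
  show "(\<lambda>n. (1 + (c * D) / real n) ^ n * h 0) \<longlonglongrightarrow> exp (c * D) * h 0"
    by (intro tendsto_intros tendsto_exp_limit_sequentially)
  have "(\<lambda>n. 1 + (c * D) / real n) \<longlonglongrightarrow> 1 + 0" by (intro tendsto_intros lim_const_over_n)
  \<comment> \<open>For negative c the inequality survives iteration only once the step factor is
    positive.\<close>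
  hence "eventually (\<lambda>n. 0 < 1 + (c * D) / real n) sequentially" by (intro order_tendstoD) auto
  with eventually_gt_at_top[of "0::nat"]
  show "eventually (\<lambda>n. (1 + (c * D) / real n) ^ n * h 0 \<le> h D) sequentially"
  proof eventually_elim
    case (elim n)
    have "(1 + (c * D) / real n) ^ k * h 0 \<le> h (real k * (D / n))" if "k \<le> n" for k
      using that
    proof (induction k)
      case (Suc k)
      have "(1 + (c * D) / real n) ^ Suc k * h 0 \<le> (1 + c * (D / n)) * h (real k * (D / n))"
        using Suc elim by (simp add: mult.assoc)
      also have "\<dots> \<le> h (real k * (D / n) + D / n)"
      proof (rule step)
        have "real k * (D / n) + D / n = real (Suc k) * (D / n)" by (simp add: algebra_simps add_divide_distrib)
        also have "\<dots> \<le> real n * (D / n)" using Suc D by (intro mult_right_mono) auto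
        finally show "real k * (D / n) + D / n \<le> D" using elim by simp
      qed (use D in auto)
      also have "real k * (D / n) + D / n = real (Suc k) * (D / n)" by (simp add: algebra_simps add_divide_distrib)
      finally show ?case .
    qed simp
    from this[of n] elim show ?case by simp
  qed
qed simp

locale density_distribution =
  fixes M :: "real measure" and f :: "real \<Rightarrow> real"
  assumes f_borel [measurable]: "f \<in> borel_measurable borel"
    and M_eq: "M = density lborel (\<lambda>x. ennreal (f x))"
    and prob: "prob_space M"
begin

lemma emeasure_eq_nn_integral:
  assumes "A \<in> sets borel"
  shows "emeasure M A = (\<integral>\<^sup>+x. ennreal (f x) * indicator A x \<partial>lborel)"
  using assms unfolding M_eq by (subst emeasure_density) auto

sublocale atomless_distribution M
proof -
  interpret prob_space M by (rule prob)
  show "atomless_distribution M"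
  proof
    show "sets M = sets borel" by (simp add: M_eq)
    fix x
    have "emeasure M {x} = (\<integral>\<^sup>+y. ennreal (f y) * indicator {x} y \<partial>lborel)"
      by (rule emeasure_eq_nn_integral) simp
    also have "\<dots> = 0" by (subst nn_integral_0_iff_AE) (auto intro: AE_mp[OF AE_lborel_singleton[of x]])
    finally show "measure M {x} = 0" by (simp add: measure_def)
  qed
qed

lemma ccdf_diff:
  assumes "u \<le> v"
  shows "ennreal (ccdf M u - ccdf M v) = (\<integral>\<^sup>+z. ennreal (f z) * indicator {u..v} z \<partial>lborel)"
proof -
  have "emeasure M {u..v} = ennreal (ccdf M u - ccdf M v)"
  proof -
    have "{u..} = {u..v} \<union> {v<..}" using assms by auto
    hence "measure M {u..} = measure M {u..v} + measure M {v<..}"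
      by (simp only:) (rule finite_measure_Union, auto)
    thus ?thesis by (simp add: emeasure_eq_measure ccdf_eq_Ici[of u] ccdf_eq[of v])
  qed
  thus ?thesis by (simp add: emeasure_eq_nn_integral)
qed

context
  fixes lam x0 \<kappa> :: real
  assumes lam: "0 < lam" and \<kappa>: "0 < \<kappa>"
    and right: "\<And>z. x0 \<le> z \<Longrightarrow> ccdf M z \<le> f z * (lam * (z - x0) + \<kappa>)"
    and left: "\<And>z. z \<le> x0 \<Longrightarrow> f z * (lam * (z - x0) + \<kappa>) \<le> ccdf M z"
begin

text \<open>With \<kappa> the value of ccdf / f at x0, regularity puts the inverse hazard rate below
  this line to the right of x0 and above it to the left. \<open>right\<close> and
  \<open>left\<close> are multiplied out by f so that they make sense where f vanishes.\<close>

definition "L z = lam * (z - x0) + \<kappa>"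

lemma L_le: "u \<le> v \<Longrightarrow> L u \<le> L v" using lam by (simp add: L_def)

lemma nn_integral_inverse_L:
  assumes "u \<le> v" "0 < L u" "0 \<le> c"
  shows "(\<integral>\<^sup>+z. ennreal (c / L z) * indicator {u..v} z \<partial>lborel) = ennreal (c * ((ln (L v) - ln (L u)) / lam))"
proof -
  have pos: "0 < L z" if "u \<le> z" for z using L_le[OF that] assms by simp
  have "(\<integral>\<^sup>+z. ennreal (c / L z) * indicator {u..v} z \<partial>lborel) = ennreal (c * ln (L v) / lam - c * ln (L u) / lam)"
  proof (rule nn_integral_FTC_Icc[where F = "\<lambda>z. c * ln (L z) / lam"])
    fix z assume z: "z \<in> {u..v}"
    have "((\<lambda>z. c * ln (L z) / lam) has_real_derivative c * (1 / L z * lam) / lam) (at z)"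
      using pos[of z] z unfolding L_def by (auto intro!: derivative_eq_intros)
    thus "((\<lambda>z. c * ln (L z) / lam) has_real_derivative c / L z) (at z)"
      using lam by simp
    show "0 \<le> c / L z" using pos[of z] z assms by simp
  qed (use assms in \<open>simp_all add: L_def\<close>)
  thus ?thesis by (simp add: algebra_simps diff_divide_distrib)
qed

text \<open>On [u, v] the density is at least ccdf v / L z, and 1 / L integrates to a logarithm.
  This is one Euler step for \<open>exp_growth\<close>, with ln L / lam as time.\<close>

lemma step_right:
  assumes "x0 \<le> u" "u \<le> v"
  shows "(1 + (ln (L v) - ln (L u)) / lam) * ccdf M v \<le> ccdf M u"
proof -
  have Lu: "0 < L u" using assms \<kappa> lam by (simp add: L_def add_nonneg_pos)
  have "ennreal (ccdf M v * ((ln (L v) - ln (L u)) / lam))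
      = (\<integral>\<^sup>+z. ennreal (ccdf M v / L z) * indicator {u..v} z \<partial>lborel)"
    using Lu assms ccdf_nonneg by (intro nn_integral_inverse_L[symmetric]) auto
  also have "\<dots> \<le> (\<integral>\<^sup>+z. ennreal (f z) * indicator {u..v} z \<partial>lborel)"
  proof (intro nn_integral_mono)
    fix z
    show "ennreal (ccdf M v / L z) * indicator {u..v} z \<le> ennreal (f z) * indicator {u..v} z"
    proof (cases "z \<in> {u..v}")
      case True
      hence "0 < L z" using Lu L_le[of u z] by simp
      moreover have "ccdf M v \<le> f z * L z"
        using True assms right[of z] ccdf_antimono[of z v] by (simp add: L_def)
      ultimately show ?thesis by (intro mult_right_mono ennreal_leI) (auto simp: pos_divide_le_eq)
    qed simp
  qed
  also have "\<dots> = ennreal (ccdf M u - ccdf M v)" using assms by (simp add: ccdf_diff)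
  finally have "ccdf M v * ((ln (L v) - ln (L u)) / lam) \<le> ccdf M u - ccdf M v"
    using ccdf_antimono[OF assms(2)] by (simp add: ennreal_le_iff)
  thus ?thesis by (simp add: algebra_simps)
qed

lemma step_left:
  assumes "v \<le> x0" "u \<le> v" "0 < L u"
  shows "(1 - (ln (L v) - ln (L u)) / lam) * ccdf M u \<le> ccdf M v"
proof -
  have "ennreal (ccdf M u - ccdf M v) = (\<integral>\<^sup>+z. ennreal (f z) * indicator {u..v} z \<partial>lborel)"
    using assms by (simp add: ccdf_diff)
  also have "\<dots> \<le> (\<integral>\<^sup>+z. ennreal (ccdf M u / L z) * indicator {u..v} z \<partial>lborel)"
  proof (intro nn_integral_mono)
    fix z
    show "ennreal (f z) * indicator {u..v} z \<le> ennreal (ccdf M u / L z) * indicator {u..v} z"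
    proof (cases "z \<in> {u..v}")
      case True
      hence "0 < L z" using assms L_le[of u z] by simp
      moreover have "f z * L z \<le> ccdf M u"
        using True assms left[of z] ccdf_antimono[of u z] by (simp add: L_def)
      ultimately show ?thesis by (intro mult_right_mono ennreal_leI) (auto simp: pos_le_divide_eq)
    qed simp
  qed
  also have "\<dots> = ennreal (ccdf M u * ((ln (L v) - ln (L u)) / lam))"
    using assms ccdf_nonneg by (intro nn_integral_inverse_L) auto
  finally have "ccdf M u - ccdf M v \<le> ccdf M u * ((ln (L v) - ln (L u)) / lam)"
    using assms ccdf_nonneg[of u] L_le[of u v] lam by (subst (asm) ennreal_le_iff) (auto intro!: mult_nonneg_nonneg)
  thus ?thesis by (simp add: algebra_simps)
qed

definition "L_inv l = x0 + (l - \<kappa>) / lam"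

lemma L_L_inv: "L (L_inv l) = l" using lam by (simp add: L_def L_inv_def)
lemma L_inv_L: "L_inv (L z) = z" using lam by (simp add: L_def L_inv_def)
lemma L_inv_mono: "l \<le> m \<Longrightarrow> L_inv l \<le> L_inv m" using lam by (simp add: L_inv_def divide_right_mono)
lemma L_x0: "L x0 = \<kappa>" by (simp add: L_def)
lemma L_inv_kappa: "L_inv \<kappa> = x0" by (simp add: L_inv_def)

text \<open>As a function of $\ln L / \lambda$, the tail decays at rate at least 1 to the right of \<open>x0\<close> and at most 1 to its left.\<close>
lemma tail_comparison:
  assumes Lz: "0 < L z"
  shows "(L z / \<kappa>) powr (1 / lam) * ccdf M z \<le> ccdf M x0"
proof -
  have ln_eq: "ln (L z * exp w) = ln (L z) + w" for w using Lz by (simp add: ln_mult)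
  show ?thesis
  proof (cases "x0 \<le> z")
    case True
    define D where "D = ln (L z / \<kappa>) / lam"
    define h where "h a = ccdf M (L_inv (L z * exp (- lam * a)))" for a
    have "\<kappa> \<le> L z" using L_le[OF True] by (simp add: L_x0)
    hence D: "0 \<le> D" using lam \<kappa> by (simp add: D_def)
    have eD: "L z * exp (- lam * D) = \<kappa>" using lam \<kappa> Lz by (simp add: D_def exp_minus)
    have "exp (1 * D) * h 0 \<le> h D"
    proof (rule exp_growth[OF D, where h = h and c = 1])
      fix a d assume ad: "0 \<le> a" "0 \<le> d" "a + d \<le> D"
      let ?u = "L_inv (L z * exp (- lam * (a + d)))" and ?v = "L_inv (L z * exp (- lam * a))"
      have "L z * exp (- lam * D) \<le> L z * exp (- lam * (a + d))"
        using ad lam Lz by (intro mult_left_mono) auto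
      hence "\<kappa> \<le> L z * exp (- lam * (a + d))" by (simp only: eD)
      hence "x0 \<le> ?u" using L_inv_mono[of \<kappa>] by (simp only: L_inv_kappa)
      moreover have "?u \<le> ?v" using ad lam Lz by (intro L_inv_mono mult_left_mono) auto
      ultimately have "(1 + (ln (L ?v) - ln (L ?u)) / lam) * ccdf M ?v \<le> ccdf M ?u" by (rule step_right)
      moreover have "(ln (L ?v) - ln (L ?u)) / lam = d"
        unfolding L_L_inv ln_eq using lam by (simp add: field_simps)
      ultimately show "(1 + 1 * d) * h a \<le> h (a + d)" by (simp add: h_def)
    qed
    moreover have "h 0 = ccdf M z" by (simp add: h_def L_inv_L)
    moreover have "h D = ccdf M x0" unfolding h_def eD by (simp only: L_inv_kappa)
    moreover have "exp D = (L z / \<kappa>) powr (1 / lam)" using Lz \<kappa> by (simp add: D_def powr_def)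
    ultimately show ?thesis by simp
  next
    case False
    define D where "D = ln (\<kappa> / L z) / lam"
    define h where "h a = ccdf M (L_inv (L z * exp (lam * a)))" for a
    have "L z \<le> \<kappa>" using L_le[of z x0] False by (simp add: L_x0)
    hence D: "0 \<le> D" using lam \<kappa> Lz by (simp add: D_def)
    have eD: "L z * exp (lam * D) = \<kappa>" using lam \<kappa> Lz by (simp add: D_def)
    have "exp (- 1 * D) * h 0 \<le> h D"
    proof (rule exp_growth[OF D, where h = h and c = "- 1"])
      fix a d assume ad: "0 \<le> a" "0 \<le> d" "a + d \<le> D"
      let ?v = "L_inv (L z * exp (lam * (a + d)))" and ?u = "L_inv (L z * exp (lam * a))"
      have "L z * exp (lam * (a + d)) \<le> L z * exp (lam * D)"
        using ad lam Lz by (intro mult_left_mono) auto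
      hence "L z * exp (lam * (a + d)) \<le> \<kappa>" by (simp only: eD)
      hence "?v \<le> x0" using L_inv_mono[of _ \<kappa>] by (simp only: L_inv_kappa)
      moreover have "?u \<le> ?v" using ad lam Lz by (intro L_inv_mono mult_left_mono) auto
      moreover have "0 < L ?u" unfolding L_L_inv using Lz by simp
      ultimately have "(1 - (ln (L ?v) - ln (L ?u)) / lam) * ccdf M ?u \<le> ccdf M ?v" by (rule step_left)
      moreover have "(ln (L ?v) - ln (L ?u)) / lam = d"
        unfolding L_L_inv ln_eq using lam by (simp add: field_simps)
      ultimately show "(1 + - 1 * d) * h a \<le> h (a + d)" by (simp add: h_def)
    qed
    moreover have "h 0 = ccdf M z" by (simp add: h_def L_inv_L)
    moreover have "h D = ccdf M x0" unfolding h_def eD by (simp only: L_inv_kappa)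
    moreover have "ln (\<kappa> / L z) = - ln (L z / \<kappa>)" using Lz \<kappa> by (simp add: ln_div)
    hence "- D = ln (L z / \<kappa>) / lam" by (simp add: D_def)
    hence "exp (- D) = (L z / \<kappa>) powr (1 / lam)" using Lz \<kappa> by (simp add: powr_def)
    ultimately show ?thesis by simp
  qed
qed

text \<open>Solving the tail comparison for z gives the supporting line at x0 in the variable s =
  ccdf^(-lam). If L z is not positive, the bound is trivial.\<close>

lemma value_le_affine:
  assumes "0 < ccdf M x0" "0 < ccdf M z"
  shows "z \<le> x0 + \<kappa> / lam * ((ccdf M z / ccdf M x0) powr (- lam) - 1)"
proof -
  have "L z \<le> \<kappa> * (ccdf M z / ccdf M x0) powr (- lam)"
  proof (cases "0 < L z")
    case True
    have "(L z / \<kappa>) powr (1 / lam) \<le> ccdf M x0 / ccdf M z"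
      using tail_comparison[OF True] assms by (simp add: pos_le_divide_eq)
    hence "((L z / \<kappa>) powr (1 / lam)) powr lam \<le> (ccdf M x0 / ccdf M z) powr lam"
      using lam by (intro powr_mono2) auto
    also have "\<dots> = (ccdf M z / ccdf M x0) powr (- lam)"
      using assms by (simp add: powr_minus powr_divide)
    finally show ?thesis using True lam \<kappa> by (simp add: powr_powr pos_divide_le_eq mult.commute)
  next
    case False
    have "0 \<le> \<kappa> * (ccdf M z / ccdf M x0) powr (- lam)" using \<kappa> by simp
    with False show ?thesis by linarith
  qed
  thus ?thesis using lam by (simp add: L_def field_simps)
qed

end

end

section \<open>From a monotone virtual value to a revenue bound\<close>

context
  fixes M :: "real measure" and f :: "real \<Rightarrow> real" and D :: "real set"
  assumes pdf: "supported_pdf M f D"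
begin

lemma D_interval: "is_interval D"
  and D_nonneg: "D \<subseteq> {0..}"
  and f_measurable: "f \<in> borel_measurable borel"
  and f_pos: "\<And>x. x \<in> D \<Longrightarrow> 0 < f x"
  and f_zero: "\<And>x. x \<notin> D \<Longrightarrow> f x = 0"
  and M_density: "M = density lborel (\<lambda>x. ennreal (f x))"
  and M_prob: "prob_space M"
  using pdf unfolding supported_pdf_def by blast+

lemma density_distribution_pdf: "density_distribution M f"
  by (rule density_distribution.intro[OF f_measurable M_density M_prob])

interpretation density_distribution M f by (rule density_distribution_pdf)

lemma AE_nonneg: "AE v in M. 0 \<le> v"
proof -
  have "f v = 0" if "\<not> 0 \<le> v" for v using that D_nonneg by (intro f_zero) auto
  hence "0 < ennreal (f v) \<Longrightarrow> 0 \<le> v" for v by fastforce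
  hence "AE v in lborel. 0 < ennreal (f v) \<longrightarrow> 0 \<le> v" by blast
  thus ?thesis unfolding M_eq by (subst AE_density) auto
qed

lemma ccdf_above:
  assumes "\<And>y. x < y \<Longrightarrow> y \<notin> D" shows "ccdf M x = 0"
proof -
  have "emeasure M {x<..} = (\<integral>\<^sup>+z. ennreal (f z) * indicator {x<..} z \<partial>lborel)"
    by (rule emeasure_eq_nn_integral) simp
  also have "\<dots> = (\<integral>\<^sup>+z. 0 \<partial>(lborel :: real measure))"
  proof (rule nn_integral_cong)
    fix z
    show "ennreal (f z) * indicator {x<..} z = 0"
      using assms[of z] f_zero[of z] by (cases "x < z") simp_all
  qed
  finally show ?thesis by (simp add: ccdf_eq measure_def)
qed

lemma ccdf_below:
  assumes "\<And>y. y < x \<Longrightarrow> y \<notin> D" shows "ccdf M x = 1"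
proof -
  have "emeasure M {..x} = (\<integral>\<^sup>+z. ennreal (f z) * indicator {..x} z \<partial>lborel)"
    by (rule emeasure_eq_nn_integral) simp
  also have "\<dots> = (\<integral>\<^sup>+z. 0 \<partial>(lborel :: real measure))"
  proof (rule nn_integral_cong_AE, rule AE_mp[OF AE_lborel_singleton[of x]], rule AE_I2, rule impI)
    fix z assume "z \<noteq> x"
    thus "ennreal (f z) * indicator {..x} z = 0"
      using assms[of z] f_zero[of z] by (cases "z < x") simp_all
  qed
  finally show ?thesis by (simp add: ccdf_def cdf_def measure_def)
qed

lemma ccdf_attained_support:
  assumes "0 < u" "u < 1" obtains x where "x \<in> D" "ccdf M x = u"
proof -
  obtain x where x: "ccdf M x = u" using ccdf_attained assms by blast
  obtain y where y: "x < y" "y \<in> D" using ccdf_above[of x] x assms by auto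
  obtain z where z: "z < x" "z \<in> D" using ccdf_below[of x] x assms by auto
  have "x \<in> D" using mem_is_interval_1_I[OF D_interval z(2) y(2)] y z by simp
  thus thesis using x by (rule that)
qed

text \<open>Comparing the virtual values at x0 and z and solving for ccdf / f yields the linear
  bound on the inverse hazard rate. For z outside D the density is 0, and to the right of x0 the
  tail is 0 as well because D is an interval.\<close>

lemma regular_value_le:
  assumes lam: "0 < lam" and regular: "mono_on D (virtual_value lam M f)"
    and x0: "x0 \<in> D" "0 < ccdf M x0" and z: "0 < ccdf M z"
  shows "z \<le> x0 + ccdf M x0 / f x0 / lam * ((ccdf M z / ccdf M x0) powr (- lam) - 1)"
proof (rule value_le_affine)
  show "0 < ccdf M x0 / f x0" using f_pos[OF x0(1)] x0(2) by simp
  show "ccdf M z \<le> f z * (lam * (z - x0) + ccdf M x0 / f x0)" if "x0 \<le> z" for z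
  proof (cases "z \<in> D")
    case True
    hence "virtual_value lam M f x0 \<le> virtual_value lam M f z"
      using mono_onD[OF regular x0(1) True that] by simp
    hence "ccdf M z / f z \<le> lam * (z - x0) + ccdf M x0 / f x0"
      by (simp add: virtual_value_def ccdf_def algebra_simps)
    thus ?thesis using f_pos[OF True] by (simp add: pos_divide_le_eq mult.commute)
  next
    case False
    have "ccdf M z = 0"
    proof (rule ccdf_above)
      fix y assume "z < y"
      thus "y \<notin> D" using False that x0(1) mem_is_interval_1_I[OF D_interval x0(1), of y z]
        by auto
    qed
    thus ?thesis using f_zero[OF False] by simp
  qed
  show "f z * (lam * (z - x0) + ccdf M x0 / f x0) \<le> ccdf M z" if "z \<le> x0" for z
  proof (cases "z \<in> D")
    case True
    hence "virtual_value lam M f z \<le> virtual_value lam M f x0"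
      using mono_onD[OF regular True x0(1) that] by simp
    hence "lam * (z - x0) + ccdf M x0 / f x0 \<le> ccdf M z / f z"
      by (simp add: virtual_value_def ccdf_def algebra_simps)
    thus ?thesis using f_pos[OF True] by (simp add: pos_le_divide_eq mult.commute)
  next
    case False
    thus ?thesis using f_zero[OF False] ccdf_nonneg by simp
  qed
qed (use lam x0 z in auto)

text \<open>x is the value at the touching point s = ccdf^(-lam), so one number controls both the
  optimal revenue and, as a price, the anonymous revenue. With s = c times
  \<open>min_moment\<close>, the upper limit on s is c <= 1.\<close>

lemma Myerson_le_price_point:
  assumes lam: "0 < lam" "lam \<le> 1" and regular: "mono_on D (virtual_value lam M f)"
    and n: "0 < n" and s: "1 < s" "s \<le> min_moment lam n"
  obtains x where "x \<in> D" "0 < x" "ccdf M x = s powr (- 1 / lam)"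
    "Myerson M n \<le> ereal (x * min_moment lam n / (s - 1))"
proof -
  define q where "q = s powr (- 1 / lam)"
  define G where "G = min_moment lam n"
  have "q < s powr 0" unfolding q_def using s lam by (intro powr_less_mono) auto
  hence q: "0 < q" "q < 1" using s by (auto simp: q_def)
  then obtain x where x: "x \<in> D" "ccdf M x = q" by (rule ccdf_attained_support)
  define \<alpha> where "\<alpha> = q / f x / lam / s"
  have fx: "0 < f x" by (rule f_pos[OF x(1)])
  have \<alpha>: "0 < \<alpha>" using fx q lam s by (simp add: \<alpha>_def)
  have qs: "q powr (- lam) = s" using s lam by (simp add: q_def powr_powr)
  have line: "z \<le> \<alpha> * ccdf M z powr (- lam) + (x - \<alpha> * s)" if "0 < ccdf M z" for z
  proof -
    have "z \<le> x + q / f x / lam * ((ccdf M z / q) powr (- lam) - 1)"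
      using regular_value_le[OF lam(1) regular x(1) _ that] x q by simp
    also have "(ccdf M z / q) powr (- lam) = ccdf M z powr (- lam) / s"
      using that q by (simp add: powr_divide qs)
    also have "x + q / f x / lam * (ccdf M z powr (- lam) / s - 1) = \<alpha> * ccdf M z powr (- lam) + (x - \<alpha> * s)"
      using s by (simp add: \<alpha>_def algebra_simps)
    finally show ?thesis .
  qed
  have "ccdf M 0 = 1" using D_nonneg by (intro ccdf_below) force
  with line[of 0] have \<alpha>_le: "\<alpha> * (s - 1) \<le> x" by (simp add: algebra_simps)
  have "0 < \<alpha> * (s - 1)" using \<alpha> s by simp
  with \<alpha>_le have x0: "0 < x" by linarith
  have "Myerson M n \<le> ereal (\<alpha> * G + max 0 (x - \<alpha> * s))"
    unfolding G_def using lam n \<alpha> AE_nonneg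
  proof (intro Myerson_le)
    fix z assume "0 < ccdf M z"
    from line[OF this] show "z \<le> \<alpha> * ccdf M z powr (- lam) + max 0 (x - \<alpha> * s)" by linarith
  qed auto
  \<comment> \<open>Both branches of the maximum are largest at \<alpha> = x / (s - 1). For the
    branch with the intercept this uses s <= G, which makes \<alpha> (G - s) + x nondecreasing in
    \<alpha>.\<close>
  also have "\<alpha> * G + max 0 (x - \<alpha> * s) \<le> x * G / (s - 1)"
  proof -
    have G: "1 < G" "s \<le> G" using s by (auto simp: G_def)
    have "\<alpha> * (s - 1) * G \<le> x * G" using \<alpha>_le G by (intro mult_right_mono) auto
    hence "(\<alpha> * G + 0) * (s - 1) \<le> x * G" by (simp add: algebra_simps)
    moreover have "(\<alpha> * G + (x - \<alpha> * s)) * (s - 1) \<le> x * G"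
    proof -
      have "(\<alpha> * G + (x - \<alpha> * s)) * (s - 1) = \<alpha> * (s - 1) * (G - s) + x * (s - 1)"
        by (simp add: algebra_simps)
      also have "\<dots> \<le> x * (G - s) + x * (s - 1)"
        using \<alpha>_le G by (intro add_right_mono mult_right_mono) auto
      also have "\<dots> \<le> x * G" using x0 by (simp add: algebra_simps)
      finally show ?thesis .
    qed
    ultimately show ?thesis using s by (subst pos_le_divide_eq) (auto simp: max_def)
  qed
  finally have "Myerson M n \<le> ereal (x * G / (s - 1))" by simp
  with x x0 show thesis unfolding q_def G_def by - (rule that, assumption+)
qed

lemma Myerson_div_Price_le:
  assumes lam: "0 < lam" "lam \<le> 1" and regular: "mono_on D (virtual_value lam M f)"
    and n: "0 < n" and s: "1 < s" "s \<le> min_moment lam n"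
  shows "Myerson M n / Price (M, D) n
    \<le> ereal (min_moment lam n / ((s - 1) * (1 - exp (- (real n * s powr (- 1 / lam))))))"
proof -
  obtain x where x: "x \<in> D" "0 < x" "ccdf M x = s powr (- 1 / lam)"
    "Myerson M n \<le> ereal (x * min_moment lam n / (s - 1))"
    by (rule Myerson_le_price_point[OF assms])
  define q where "q = s powr (- 1 / lam)"
  define w where "w = 1 - exp (- (real n * q))"
  have q: "0 < q" using s by (simp add: q_def)
  hence w: "0 < w" using n by (simp add: w_def)
  have cdf: "cdf M x = 1 - q" using x by (simp add: ccdf_def q_def)
  have "cdf M x ^ n \<le> exp (- q) ^ n"
    unfolding cdf using exp_ge_add_one_self[of "- q"] ccdf_le_1[of x] x(3)
    by (intro power_mono) (auto simp: q_def)
  also have "\<dots> = exp (- (real n * q))" by (simp add: exp_of_nat_mult[symmetric])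
  finally have "x * w \<le> x * (1 - cdf M x ^ n)" using x by (intro mult_left_mono) (auto simp: w_def)
  hence "ereal (x * w) \<le> ereal (x * (1 - cdf M x ^ n))" by simp
  also have "\<dots> \<le> Price (M, D) n" unfolding Price_def using x by (intro SUP_upper2[of x]) auto
  finally have price: "ereal (x * w) \<le> Price (M, D) n" .
  show ?thesis
  proof (cases "Price (M, D) n")
    case (real P)
    with price have P: "x * w \<le> P" by simp
    moreover have "0 < x * w" using x w by simp
    ultimately have "0 < P" by linarith
    have "x * min_moment lam n / (s - 1) = (x * w) * (min_moment lam n / ((s - 1) * w))"
      using w by simp
    also have "\<dots> \<le> P * (min_moment lam n / ((s - 1) * w))"
      using P s w by (intro mult_right_mono) auto
    finally have "Myerson M n \<le> ereal (P * (min_moment lam n / ((s - 1) * w)))"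
      using x(4) by (meson ereal_less_eq(3) order.trans)
    thus ?thesis unfolding real using \<open>0 < P\<close>
      by (subst ereal_divide_le_pos) (auto simp: w_def q_def)
  next
    \<comment> \<open>Division by an infinite anonymous revenue gives 0.\<close>
    case PInf
    thus ?thesis using s w by (auto simp: w_def q_def intro!: divide_nonneg_nonneg)
  next
    case MInf
    with price show ?thesis by simp
  qed
qed

end

lemma APX_le:
  assumes "0 < lam" "lam \<le> 1" "0 < n" "1 < s" "s \<le> min_moment lam n"
  shows "APX n lam \<le> ereal (min_moment lam n / ((s - 1) * (1 - exp (- (real n * s powr (- 1 / lam))))))"
  unfolding APX_def
proof (rule SUP_least)
  fix MD assume "MD \<in> regular_dists lam"
  then obtain M D f where "MD = (M, D)" "supported_pdf M f D" "mono_on D (virtual_value lam M f)"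
    unfolding regular_dists_def by blast
  with Myerson_div_Price_le[OF this(2) assms(1,2) this(3) assms(3-5)]
  show "Myerson (fst MD) n / Price MD n
    \<le> ereal (min_moment lam n / ((s - 1) * (1 - exp (- (real n * s powr (- 1 / lam))))))" by simp
qed

subsection \<open>Shifted Pareto distributions\<close>

definition rival_max :: "nat \<Rightarrow> (nat \<Rightarrow> real) \<Rightarrow> nat \<Rightarrow> real" where
  "rival_max n v i = Max (v ` ({..<n} - {i}))"

text \<open>Nobody wins in case of a tie, so that no tie-breaking rule is needed.\<close>
definition second_price_alloc :: "nat \<Rightarrow> (nat \<Rightarrow> real) \<Rightarrow> nat \<Rightarrow> real" where
  "second_price_alloc n v i = (if rival_max n v i < v i then 1 else 0)"

definition second_price_pay :: "nat \<Rightarrow> (nat \<Rightarrow> real) \<Rightarrow> nat \<Rightarrow> real" where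
  "second_price_pay n v i = rival_max n v i * second_price_alloc n v i"

lemma rivals_nonempty: "2 \<le> n \<Longrightarrow> {..<n} - {i} \<noteq> {}" for n i :: nat
proof -
  assume "2 \<le> n"
  hence "(if i = 0 then 1 else 0) \<in> {..<n} - {i}" by auto
  thus ?thesis by blast
qed

text \<open>The own bid decides only whether the rival maximum is paid, never its amount; incentive
  compatibility rests on this.\<close>

lemma rival_max_upd: "rival_max n (v(i := b)) i = rival_max n v i"
  unfolding rival_max_def by (intro arg_cong[of _ _ Max] image_cong) auto

lemma rival_max_measurable [measurable]:
  assumes "2 \<le> n" shows "(\<lambda>v. rival_max n v i) \<in> borel_measurable (PiM {..<n} (\<lambda>_. borel))"
  unfolding rival_max_def using rivals_nonempty[OF assms]
  by (intro borel_measurable_Max measurable_component_singleton) auto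

lemma truthful_second_price:
  assumes n: "2 \<le> n"
  shows "truthful_auction n (second_price_alloc n) (second_price_pay n)"
  unfolding truthful_auction_def
proof (intro conjI ballI allI impI)
  fix i assume i: "i < n"
  have [measurable]: "(\<lambda>v. v i) \<in> borel_measurable (PiM {..<n} (\<lambda>_. borel :: real measure))"
    using i by (intro measurable_component_singleton) auto
  show m: "(\<lambda>v. second_price_alloc n v i) \<in> borel_measurable (PiM {..<n} (\<lambda>_. borel))"
    unfolding second_price_alloc_def using n by measurable
  show "(\<lambda>v. second_price_pay n v i) \<in> borel_measurable (PiM {..<n} (\<lambda>_. borel))"
    unfolding second_price_pay_def using n m by measurable
next
  fix v
  show "(\<Sum>i<n. second_price_alloc n v i) \<le> 1"
  proof (cases "\<exists>k<n. rival_max n v k < v k")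
    case True
    then obtain k where k: "k < n" "rival_max n v k < v k" by blast
    have "second_price_alloc n v j = 0" if "j < n" "j \<noteq> k" for j
    proof -
      have "v j \<le> rival_max n v k" unfolding rival_max_def using that by (intro Max_ge) auto
      also have "\<dots> < v k" by fact
      also have "\<dots> \<le> rival_max n v j" unfolding rival_max_def using that k by (intro Max_ge) auto
      finally show ?thesis by (simp add: second_price_alloc_def)
    qed
    hence "(\<Sum>i<n. second_price_alloc n v i) = (\<Sum>i\<in>{k}. second_price_alloc n v i)"
      using k by (intro sum.mono_neutral_right) auto
    thus ?thesis by (simp add: second_price_alloc_def)
  qed (simp add: second_price_alloc_def)
qed (auto simp: second_price_alloc_def second_price_pay_def rival_max_upd)

section \<open>The extremal distributions and their revenue\<close>

context
  fixes lam a b :: real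
  assumes lam: "0 < lam" "lam \<le> 1" and a: "0 < a" and b: "0 \<le> b"
begin

text \<open>The law of $a U^{-\lambda} + b$ for uniform \<open>U\<close>; its virtual value is constant.\<close>
definition pareto_pdf :: "real \<Rightarrow> real" where
  "pareto_pdf x = (if x < a + b then 0 else 1 / (lam * a) * ((x - b) / a) powr (- 1 / lam - 1))"

definition pareto :: "real measure" where
  "pareto = density lborel (\<lambda>x. ennreal (pareto_pdf x))"

lemma pareto_pdf_measurable [measurable]: "pareto_pdf \<in> borel_measurable borel"
  unfolding pareto_pdf_def by measurable

lemma pareto_pdf_nonneg: "0 \<le> pareto_pdf x"
  using lam a by (simp add: pareto_pdf_def)

lemma nn_integral_pareto_pdf:
  assumes x: "a + b \<le> x"
  shows "(\<integral>\<^sup>+z. ennreal (pareto_pdf z) * indicator {x..} z \<partial>lborel) = ennreal (((x - b) / a) powr (- 1 / lam))"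
proof -
  let ?F = "\<lambda>z. - (((z - b) / a) powr (- 1 / lam))"
  have "(\<integral>\<^sup>+z. ennreal (pareto_pdf z) * indicator {x..} z \<partial>lborel) = ennreal (- 0 - ?F x)"
  proof (rule nn_integral_FTC_atLeast)
    fix z assume z: "x \<le> z"
    hence pos: "0 < (z - b) / a" using x a by simp
    have "(?F has_real_derivative - ((- 1 / lam) * ((z - b) / a) powr (- 1 / lam - 1) * (1 / a))) (at z)"
      using pos a by (auto intro!: derivative_eq_intros)
    thus "(?F has_real_derivative pareto_pdf z) (at z)"
      using z x by (simp add: pareto_pdf_def)
    show "0 \<le> pareto_pdf z" by (rule pareto_pdf_nonneg)
  next
    have "filterlim (\<lambda>z. (z - b) / a) at_top at_top"
      unfolding filterlim_at_top
    proof
      fix Z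
      show "eventually (\<lambda>z. Z \<le> (z - b) / a) at_top"
        using eventually_ge_at_top[of "Z * a + b"]
        by eventually_elim (use a in \<open>simp add: pos_le_divide_eq\<close>)
    qed
    thus "(?F \<longlongrightarrow> - 0) at_top"
      using lam by (intro tendsto_minus tendsto_neg_powr) auto
  qed simp
  thus ?thesis by simp
qed

lemma density_distribution_pareto: "density_distribution pareto pareto_pdf"
proof (rule density_distribution.intro)
  show "prob_space pareto"
  proof
    have "emeasure pareto (space pareto) = (\<integral>\<^sup>+z. ennreal (pareto_pdf z) * indicator UNIV z \<partial>lborel)"
      unfolding pareto_def by (subst emeasure_density) auto
    also have "\<dots> = (\<integral>\<^sup>+z. ennreal (pareto_pdf z) * indicator {a + b..} z \<partial>lborel)"
      by (intro nn_integral_cong) (auto simp: pareto_pdf_def indicator_def)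
    also have "\<dots> = 1" using nn_integral_pareto_pdf[of "a + b"] a by simp
    finally show "emeasure pareto (space pareto) = 1" .
  qed
qed (auto simp: pareto_def)

interpretation density_distribution pareto pareto_pdf
  by (rule density_distribution_pareto)

lemma ccdf_pareto:
  assumes "a + b \<le> x" shows "ccdf pareto x = ((x - b) / a) powr (- 1 / lam)"
proof -
  have "emeasure pareto {x..} = (\<integral>\<^sup>+z. ennreal (pareto_pdf z) * indicator {x..} z \<partial>lborel)"
    by (rule emeasure_eq_nn_integral) simp
  thus ?thesis using nn_integral_pareto_pdf[OF assms]
    by (simp add: ccdf_eq_Ici measure_def)
qed

lemma pareto_value:
  assumes "a + b \<le> x" shows "x = a * ccdf pareto x powr (- lam) + b" and "0 < ccdf pareto x"
proof -
  have pos: "0 < (x - b) / a" using assms a by simp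
  have "(y powr (- 1 / lam)) powr (- lam) = y" if "0 < y" for y
    using that lam by (simp add: powr_powr)
  from this[OF pos] have "ccdf pareto x powr (- lam) = (x - b) / a"
    unfolding ccdf_pareto[OF assms] .
  thus "x = a * ccdf pareto x powr (- lam) + b" using a by simp
  show "0 < ccdf pareto x" unfolding ccdf_pareto[OF assms] using pos by auto
qed

lemma supported_pareto: "supported_pdf pareto pareto_pdf {a + b..}"
  unfolding supported_pdf_def using prob_space_axioms lam a b
  by (auto simp: pareto_def pareto_pdf_def is_interval_ci)

lemma pareto_regular: "(pareto, {a + b..}) \<in> regular_dists lam"
proof -
  have "virtual_value lam pareto pareto_pdf x = lam * b" if x: "a + b \<le> x" for x
  proof -
    define y where "y = (x - b) / a"
    have y: "0 < y" "x = a * y + b" using x a by (auto simp: y_def)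
    have 1: "1 - cdf pareto x = y powr (- 1 / lam)"
      using ccdf_pareto[OF x] by (simp add: ccdf_def y_def)
    have 2: "pareto_pdf x = 1 / (lam * a) * (y powr (- 1 / lam) / y)"
      using x y(1) by (simp add: pareto_pdf_def y_def[symmetric] powr_diff)
    have "(1 - cdf pareto x) / pareto_pdf x = lam * a * y"
      unfolding 1 2 using y(1) lam a by simp
    thus ?thesis using y(2) by (simp add: virtual_value_def algebra_simps)
  qed
  thus ?thesis using supported_pareto
    unfolding regular_dists_def by (auto intro!: exI[of _ pareto_pdf] mono_onI)
qed

lemma AE_pareto_support: "AE v in pareto. a + b \<le> v"
  unfolding pareto_def by (subst AE_density) (auto simp: pareto_pdf_def)

text \<open>Against the highest rival value y, a bidder pays y with probability
  \<open>ccdf pareto y\<close>, which is the revenue curve at that quantile; the highest of the n -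
  1 rival values has the smallest quantile.\<close>

lemma nn_integral_second_price_pay:
  assumes n: "2 \<le> n" and i: "i < n"
  shows "(\<integral>\<^sup>+v. ennreal (second_price_pay n v i) \<partial>PiM {..<n} (\<lambda>_. pareto))
    = (\<integral>\<^sup>+u. ennreal (a * u powr (1 - lam) + b * u) \<partial>min_uniform (n - 1))"
proof -
  define J where "J = {..<n} - {i}"
  have J: "{..<n} = insert i J" "finite J" "i \<notin> J" using i by (auto simp: J_def)
  have cardJ: "card J = n - 1" using i by (simp add: J_def)
  have Jne: "J \<noteq> {}" unfolding J_def by (rule rivals_nonempty[OF n])
  have meas: "(\<lambda>v. second_price_pay n v i) \<in> borel_measurable (PiM (insert i J) (\<lambda>_. pareto))"
    using truthful_second_price[OF n] i unfolding truthful_auction_def J(1)[symmetric]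
    by (simp cong: measurable_cong_sets add: sets_PiM_M)
  have "(\<integral>\<^sup>+v. ennreal (second_price_pay n v i) \<partial>PiM {..<n} (\<lambda>_. pareto))
      = (\<integral>\<^sup>+v. \<integral>\<^sup>+z. ennreal (second_price_pay n (v(i := z)) i) \<partial>pareto \<partial>PiM J (\<lambda>_. pareto))"
    unfolding J(1) using J meas by (intro product.product_nn_integral_insert) auto
  also have "\<dots> = (\<integral>\<^sup>+v. ennreal (a * Min ((\<lambda>j. ccdf pareto (v j)) ` J) powr (1 - lam)
      + b * Min ((\<lambda>j. ccdf pareto (v j)) ` J)) \<partial>PiM J (\<lambda>_. pareto))"
  proof (rule nn_integral_cong_AE)
    have "AE v in PiM J (\<lambda>_. pareto). \<forall>j\<in>J. a + b \<le> v j"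
      using J AE_pareto_support
      by (intro AE_finite_allI AE_PiM_component[of J "\<lambda>_. pareto"] prob_space_axioms) auto
    thus "AE v in PiM J (\<lambda>_. pareto). (\<integral>\<^sup>+z. ennreal (second_price_pay n (v(i := z)) i) \<partial>pareto)
        = ennreal (a * Min ((\<lambda>j. ccdf pareto (v j)) ` J) powr (1 - lam) + b * Min ((\<lambda>j. ccdf pareto (v j)) ` J))"
    proof (rule AE_mp, intro AE_I2 impI)
      fix v assume v: "\<forall>j\<in>J. a + b \<le> v j"
      define y where "y = rival_max n v i"
      have y_eq: "y = Max (v ` J)" by (simp add: y_def rival_max_def J_def)
      have "y \<in> v ` J" unfolding y_eq using J Jne by (intro Max_in) auto
      then obtain k where k: "k \<in> J" "y = v k" by blast
      have y: "a + b \<le> y" using k v by simp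
      have min: "Min ((\<lambda>j. ccdf pareto (v j)) ` J) = ccdf pareto y"
      proof (rule Min_eqI)
        fix c assume "c \<in> (\<lambda>j. ccdf pareto (v j)) ` J"
        then obtain j where j: "j \<in> J" "c = ccdf pareto (v j)" by blast
        have "v j \<le> y" unfolding y_eq using j J by (intro Max_ge) auto
        thus "ccdf pareto y \<le> c" unfolding j(2) by (rule ccdf_antimono)
      qed (use k J in auto)
      have "(\<integral>\<^sup>+z. ennreal (second_price_pay n (v(i := z)) i) \<partial>pareto)
          = (\<integral>\<^sup>+z. ennreal y * indicator {y<..} z \<partial>pareto)"
        by (intro nn_integral_cong)
          (auto simp: second_price_pay_def second_price_alloc_def rival_max_upd y_def indicator_def)
      also have "\<dots> = ennreal y * ennreal (ccdf pareto y)"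
        by (subst nn_integral_cmult_indicator) (auto simp: ccdf_eq emeasure_eq_measure)
      also have "\<dots> = ennreal (y * ccdf pareto y)"
        using y a b ccdf_nonneg by (intro ennreal_mult[symmetric]) auto
      also have "y * ccdf pareto y = (a * ccdf pareto y powr (- lam) + b) * ccdf pareto y"
        using pareto_value(1)[OF y] by simp
      also have "\<dots> = a * ccdf pareto y powr (1 - lam) + b * ccdf pareto y"
        using pareto_value(2)[OF y] by (simp add: powr_diff powr_minus field_simps)
      finally show "(\<integral>\<^sup>+z. ennreal (second_price_pay n (v(i := z)) i) \<partial>pareto)
        = ennreal (a * Min ((\<lambda>j. ccdf pareto (v j)) ` J) powr (1 - lam) + b * Min ((\<lambda>j. ccdf pareto (v j)) ` J))"
        unfolding min .
    qed
  qed
  also have "\<dots> = (\<integral>\<^sup>+u. ennreal (a * u powr (1 - lam) + b * u) \<partial>min_uniform (card J))"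
    using J Jne by (intro nn_integral_Min_ccdf) auto
  finally show ?thesis unfolding cardJ .
qed

lemma nn_integral_min_uniform_pay:
  assumes n: "2 \<le> n"
  shows "(\<integral>\<^sup>+u. ennreal (a * u powr (1 - lam) + b * u) \<partial>min_uniform (n - 1))
    = ennreal ((a * min_moment lam n + b) / real n)"
proof -
  have Gn: "Gamma (real n + 1) = real n * Gamma (real n)" "0 < Gamma (real n)"
    using Gamma_plus1[of "real n"] nonpos_Ints_nonpos[of "real n"] n by (auto intro!: Gamma_real_pos)
  have Gn': "0 < Gamma (real n + 1 - lam)" "0 < Gamma (2 - lam)"
    using lam n by (auto intro!: Gamma_real_pos)
  have "(\<integral>\<^sup>+u. ennreal (a * u powr (1 - lam) + b * u) \<partial>min_uniform (n - 1))
      = (\<integral>\<^sup>+u. ennreal a * ennreal (u powr (1 - lam)) + ennreal b * ennreal (u powr 1) \<partial>min_uniform (n - 1))"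
    unfolding min_uniform_def using a b
    by (subst (1 2) nn_integral_density)
      (auto intro!: nn_integral_cong simp: indicator_def ennreal_mult[symmetric] ennreal_plus[symmetric] simp del: ennreal_plus)
  also have "\<dots> = ennreal a * (\<integral>\<^sup>+u. ennreal (u powr (1 - lam)) \<partial>min_uniform (n - 1))
      + ennreal b * (\<integral>\<^sup>+u. ennreal (u powr 1) \<partial>min_uniform (n - 1))"
    by (subst nn_integral_add) (auto simp: nn_integral_cmult)
  also have "(\<integral>\<^sup>+u. ennreal (u powr (1 - lam)) \<partial>min_uniform (n - 1))
      = ennreal (Gamma (2 - lam) * Gamma (real n) / Gamma (real n + 1 - lam))"
    using nn_integral_min_uniform_powr[of "2 - lam" "n - 1"] lam n by (simp add: of_nat_diff algebra_simps)
  also have "(\<integral>\<^sup>+u. ennreal (u powr 1) \<partial>min_uniform (n - 1)) = ennreal (1 / real n)"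
    using nn_integral_min_uniform_powr[of 2 "n - 1"] n Gn less_imp_neq[OF Gn(2)]
    by (simp add: of_nat_diff add.commute Gamma_numeral)
  also have "ennreal a * ennreal (Gamma (2 - lam) * Gamma (real n) / Gamma (real n + 1 - lam)) + ennreal b * ennreal (1 / real n)
      = ennreal (a * (Gamma (2 - lam) * Gamma (real n) / Gamma (real n + 1 - lam)) + b * (1 / real n))"
    using a b n Gn(2) Gn' by (simp add: ennreal_mult[symmetric] ennreal_plus[symmetric] del: ennreal_plus)
  also have "a * (Gamma (2 - lam) * Gamma (real n) / Gamma (real n + 1 - lam)) + b * (1 / real n)
      = (a * min_moment lam n + b) / real n"
    using n by (simp add: min_moment_def Gn(1) add_divide_distrib)
  finally show ?thesis .
qed

text \<open>The n equal payments add up to the bound of \<open>Myerson_le\<close> for this very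
  line. A reserve price would not help, since b >= 0 keeps the usual virtual value (1 - lam) x + lam
  b nonnegative.\<close>

lemma Myerson_pareto_ge:
  assumes n: "2 \<le> n"
  shows "ereal (a * min_moment lam n + b) \<le> Myerson pareto n"
proof -
  let ?P = "PiM {..<n} (\<lambda>_. pareto)"
  let ?r = "\<lambda>v. \<Sum>i<n. second_price_pay n v i"
  have meas [measurable]: "(\<lambda>v. second_price_pay n v i) \<in> borel_measurable ?P" if "i < n" for i
    using truthful_second_price[OF n] that unfolding truthful_auction_def
    by (simp cong: measurable_cong_sets add: sets_PiM_M)
  have "AE v in ?P. \<forall>j\<in>{..<n}. a + b \<le> v j"
    using AE_pareto_support
    by (intro AE_finite_allI AE_PiM_component[of "{..<n}" "\<lambda>_. pareto"] prob_space_axioms) auto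
  hence nonneg: "AE v in ?P. \<forall>i<n. 0 \<le> second_price_pay n v i"
  proof (rule AE_mp, intro AE_I2 impI allI)
    fix v i assume v: "\<forall>j\<in>{..<n}. a + b \<le> v j" and "i < n"
    have "rival_max n v i \<in> v ` ({..<n} - {i})"
      unfolding rival_max_def using rivals_nonempty[OF n] by (intro Max_in) auto
    then obtain k where "k < n" "rival_max n v i = v k" by auto
    hence "0 \<le> rival_max n v i" using v a b by (metis add_nonneg_nonneg lessThan_iff less_imp_le order.trans)
    thus "0 \<le> second_price_pay n v i" by (simp add: second_price_pay_def second_price_alloc_def)
  qed
  hence r_nonneg: "AE v in ?P. 0 \<le> ?r v"
    by (rule AE_mp) (auto intro!: AE_I2 sum_nonneg)
  have G: "0 \<le> a * min_moment lam n + b"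
    using a b n min_moment_pos[of lam n] lam by simp
  have "(\<integral>\<^sup>+v. ennreal (?r v) \<partial>?P) = (\<integral>\<^sup>+v. (\<Sum>i<n. ennreal (second_price_pay n v i)) \<partial>?P)"
    by (rule nn_integral_cong_AE, rule AE_mp[OF nonneg]) (auto intro!: AE_I2 sum_ennreal[symmetric])
  also have "\<dots> = (\<Sum>i<n. ennreal ((a * min_moment lam n + b) / real n))"
    using nn_integral_second_price_pay[OF n] nn_integral_min_uniform_pay[OF n]
    by (subst nn_integral_sum) auto
  also have "\<dots> = ennreal (a * min_moment lam n + b)"
    using n G by (simp add: ennreal_of_nat_eq_real_of_nat ennreal_mult[symmetric])
  finally have nn: "(\<integral>\<^sup>+v. ennreal (?r v) \<partial>?P) = ennreal (a * min_moment lam n + b)" .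
  have r_meas: "?r \<in> borel_measurable ?P" by measurable
  have int: "integrable ?P ?r"
    by (rule integrableI_nn_integral_finite[OF r_meas r_nonneg nn])
  have "(\<integral>v. ?r v \<partial>?P) = a * min_moment lam n + b"
    using integral_eq_nn_integral[OF r_meas r_nonneg] nn G by simp
  thus ?thesis unfolding Myerson_def using truthful_second_price[OF n] int
    by (intro SUP_upper2[of "(second_price_alloc n, second_price_pay n)"]) auto
qed

end

text \<open>The error has to be multiplicative and uniform in u: prices grow without bound as u
  tends to 0, and a fixed additive error would be multiplied by them.\<close>

lemma one_minus_power_le:
  fixes u :: real
  assumes u: "0 < u" "u \<le> 1" and n: "0 < n"
  shows "1 - (1 - u) ^ n \<le> (1 + 6 / real n) * (1 - exp (- (real n * u)))"
proof -
  define t where "t = real n * u"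
  have t: "0 < t" using u n by (simp add: t_def)
  have "exp (- u) \<le> 1 / (1 + u)"
    using exp_ge_add_one_self[of u] u by (simp add: exp_minus field_simps)
  also have "\<dots> \<le> 1 - u + u\<^sup>2" using u by (simp add: field_simps power2_eq_square)
  finally have d: "exp (- u) - (1 - u) \<le> u\<^sup>2" by simp
  have le: "1 - u \<le> exp (- u)" using exp_ge_add_one_self[of "- u"] by simp
  have pow: "x ^ n - y ^ n \<le> real n * (x - y) * x ^ (n - 1)" if "0 \<le> y" "y \<le> x" for x y :: real
  proof -
    have "x ^ n - y ^ n = (x - y) * (\<Sum>i<n. y ^ (n - Suc i) * x ^ i)"
      by (rule power_diff_sumr2)
    also have "\<dots> \<le> (x - y) * (\<Sum>i<n. x ^ (n - 1))"
    proof (intro mult_left_mono sum_mono)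
      fix i assume i: "i \<in> {..<n}"
      have "y ^ (n - Suc i) * x ^ i \<le> x ^ (n - Suc i) * x ^ i"
        using that by (intro mult_right_mono power_mono) auto
      also have "\<dots> = x ^ (n - 1)" using i by (simp add: power_add[symmetric])
      finally show "y ^ (n - Suc i) * x ^ i \<le> x ^ (n - 1)" .
    qed (use that in auto)
    finally show ?thesis by (simp add: mult_ac)
  qed
  have "exp (- u) ^ n - (1 - u) ^ n \<le> real n * (exp (- u) - (1 - u)) * exp (- u) ^ (n - 1)"
    using u le by (intro pow) auto
  also have "\<dots> \<le> real n * u\<^sup>2 * exp (- u) ^ (n - 1)"
    using d by (intro mult_right_mono mult_left_mono) auto
  also have "exp (- u) ^ (n - 1) = exp u * exp (- t)"
    using n by (simp add: t_def exp_of_nat_mult[symmetric] exp_add[symmetric] of_nat_diff algebra_simps)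
  \<comment> \<open>The constant 6 is 3 * 2, from e^u <= 3 here and t^2 / 2 <= e^t - 1
    below.\<close>
  also have "real n * u\<^sup>2 * (exp u * exp (- t)) \<le> real n * u\<^sup>2 * (3 * exp (- t))"
    using u exp_le by (intro mult_left_mono mult_right_mono order.trans[of "exp u" "exp 1" 3]) auto
  also have "\<dots> = 6 / real n * (exp (- t) * (t\<^sup>2 / 2))"
    using n by (simp add: t_def power2_eq_square)
  also have "\<dots> \<le> 6 / real n * (exp (- t) * (exp t - 1))"
    using exp_lower_Taylor_quadratic[of t] t by (intro mult_left_mono) auto
  also have "exp (- t) * (exp t - 1) = 1 - exp (- t)" by (simp add: exp_minus algebra_simps)
  also have "exp (- u) ^ n = exp (- t)" by (simp add: t_def exp_of_nat_mult[symmetric])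
  finally have "exp (- t) - (1 - u) ^ n \<le> 6 / real n * (1 - exp (- t))" .
  moreover have "(1 + 6 / real n) * (1 - exp (- t)) = (1 - exp (- t)) + 6 / real n * (1 - exp (- t))"
    by (simp add: distrib_right)
  ultimately show ?thesis unfolding t_def[symmetric] by linarith
qed

lemma APX_ge:
  assumes lam: "0 < lam" "lam \<le> 1" and a: "0 < a" and b: "0 \<le> b" and n: "2 \<le> n"
    and line: "\<And>t. 0 < t \<Longrightarrow> (a * t powr (- lam) + b) * (1 - exp (- t)) \<le> 1"
  shows "ereal ((a * (min_moment lam n / real n powr lam) + b) / (1 + 6 / real n)) \<le> APX n lam"
proof -
  \<comment> \<open>The scale n^(-lam) turns the tail u into t = n u, the variable of
    \<open>line\<close>.\<close>
  define a' where "a' = a * real n powr (- lam)"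
  have a': "0 < a'" using a n by (simp add: a'_def)
  let ?M = "pareto lam a' b" and ?D = "{a' + b..}"
  note params = lam a' b
  interpret density_distribution ?M "pareto_pdf lam a' b"
    by (rule density_distribution_pareto[OF params])
  have price_le: "Price (?M, ?D) n \<le> ereal (1 + 6 / real n)"
    unfolding Price_def
  proof (rule SUP_least)
    fix x assume "x \<in> snd (?M, ?D)"
    hence x: "a' + b \<le> x" by simp
    define u where "u = ccdf ?M x"
    have u: "0 < u" "u \<le> 1" using pareto_value(2)[OF params x] ccdf_le_1 by (auto simp: u_def)
    have "x = a' * u powr (- lam) + b" unfolding u_def by (rule pareto_value(1)[OF params x])
    also have "a' * u powr (- lam) = a * (real n * u) powr (- lam)"
      using u n by (simp add: a'_def powr_mult)
    finally have x_eq: "x = a * (real n * u) powr (- lam) + b" .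
    have "x * (1 - cdf ?M x ^ n) = x * (1 - (1 - u) ^ n)" by (simp add: u_def ccdf_def)
    also have "\<dots> \<le> x * ((1 + 6 / real n) * (1 - exp (- (real n * u))))"
      using x a' b u n by (intro mult_left_mono one_minus_power_le) auto
    also have "\<dots> = (1 + 6 / real n) * ((a * (real n * u) powr (- lam) + b) * (1 - exp (- (real n * u))))"
      by (simp add: x_eq mult_ac)
    also have "\<dots> \<le> (1 + 6 / real n) * 1" using u n by (intro mult_left_mono line) auto
    finally show "ereal (x * (1 - cdf (fst (?M, ?D)) x ^ n)) \<le> ereal (1 + 6 / real n)" by simp
  qed
  \<comment> \<open>The lowest price sells surely; it keeps the denominator positive, so that the
    quotient is a genuine division.\<close>
  have "ereal ((a' + b) * (1 - cdf ?M (a' + b) ^ n)) \<le> Price (?M, ?D) n"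
    unfolding Price_def by (rule SUP_upper2[of "a' + b"]) auto
  moreover have "cdf ?M (a' + b) = 0"
    using ccdf_pareto[OF params, of "a' + b"] a' by (simp add: ccdf_def)
  ultimately have "ereal (a' + b) \<le> Price (?M, ?D) n" using n by (simp add: power_0_left)
  hence price_pos: "0 < Price (?M, ?D) n"
    by (rule less_le_trans[rotated]) (use a' b in simp)
  then obtain P where P: "Price (?M, ?D) n = ereal P" "0 < P" "P \<le> 1 + 6 / real n"
    using price_le by (cases "Price (?M, ?D) n") auto
  define R where "R = a' * min_moment lam n + b"
  have R: "0 \<le> R" using a' b n min_moment_pos[OF lam, of n] by (simp add: R_def)
  have "a * (min_moment lam n / real n powr lam) + b = R"
    by (simp add: R_def a'_def powr_minus field_simps)
  hence "ereal ((a * (min_moment lam n / real n powr lam) + b) / (1 + 6 / real n)) \<le> ereal (R / P)"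
    using R P by (auto intro!: divide_left_mono mult_pos_pos add_pos_nonneg)
  also have "\<dots> \<le> Myerson ?M n / Price (?M, ?D) n"
    unfolding P(1) using P(2) Myerson_pareto_ge[OF params n]
    by (subst ereal_le_divide_pos) (auto simp: R_def)
  also have "\<dots> \<le> APX n lam"
    unfolding APX_def using pareto_regular[OF params] by (intro SUP_upper2[of "(?M, ?D)"]) auto
  finally show ?thesis .
qed

subsection \<open>The limit\<close>

text \<open>Euler's limit for Gamma: the Pochhammer symbol in \<open>Gamma_series'\<close> equals
  Gamma(n + 2 - lam) / Gamma(2 - lam), one step beyond the denominator of \<open>min_moment\<close>,
  and the factor 1 + (1 - lam) / n makes up for the shift.\<close>

lemma min_moment_asymp:
  assumes lam: "0 < lam" "lam \<le> 1"
  shows "(\<lambda>n. min_moment lam n / real n powr lam) \<longlonglongrightarrow> Gamma (2 - lam)"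
proof (rule Lim_transform_eventually)
  have "(\<lambda>n. Gamma_series' (2 - lam) n * (1 + (1 - lam) / real n)) \<longlonglongrightarrow> Gamma (2 - lam) * (1 + 0)"
    by (intro tendsto_intros Gamma_series'_LIMSEQ lim_const_over_n)
  thus "(\<lambda>n. Gamma_series' (2 - lam) n * (1 + (1 - lam) / real n)) \<longlonglongrightarrow> Gamma (2 - lam)" by simp
  show "eventually (\<lambda>n. Gamma_series' (2 - lam) n * (1 + (1 - lam) / real n)
      = min_moment lam n / real n powr lam) sequentially"
    using eventually_gt_at_top[of 0]
  proof eventually_elim
    case (elim n)
    define m where "m = real n + 1 - lam"
    have m: "0 < m" using elim lam by (simp add: m_def)
    have nonpos: "2 - lam \<notin> \<int>\<^sub>\<le>\<^sub>0" "m \<notin> \<int>\<^sub>\<le>\<^sub>0" "real n \<notin> \<int>\<^sub>\<le>\<^sub>0"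
      using nonpos_Ints_nonpos[of "2 - lam"] nonpos_Ints_nonpos[of m] nonpos_Ints_nonpos[of "real n"]
        lam m elim by auto
    have "pochhammer (2 - lam) n = Gamma (m + 1) / Gamma (2 - lam)"
      using pochhammer_Gamma[OF nonpos(1), of n] by (simp add: m_def algebra_simps)
    also have "Gamma (m + 1) = m * Gamma m" by (rule Gamma_plus1[OF nonpos(2)])
    finally have poch: "pochhammer (2 - lam) n = m * Gamma m / Gamma (2 - lam)" .
    have fact: "fact (n - 1) = Gamma (real n + 1) / real n"
      using elim Gamma_fact[of "n - 1", where 'a = real] Gamma_plus1[OF nonpos(3)] by (simp add: of_nat_diff)
    have "exp ((2 - lam) * ln (real n)) = real n powr (2 - lam)" using elim by (simp add: powr_def)
    also have "\<dots> = real n * real n / real n powr lam"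
      using elim by (simp add: powr_diff power2_eq_square)
    finally have pow: "exp ((2 - lam) * ln (real n)) = real n * real n / real n powr lam" .
    have frac: "1 + (1 - lam) / real n = m / real n" using elim by (simp add: m_def field_simps)
    have pos: "0 < Gamma m" "0 < Gamma (2 - lam)" using m lam by (auto intro!: Gamma_real_pos)
    have series: "Gamma_series' (2 - lam) n
        = fact (n - 1) * (real n * real n / real n powr lam) / pochhammer (2 - lam) n"
      unfolding Gamma_series'_def pow[symmetric] by simp
    show ?case
      unfolding series min_moment_def poch fact frac m_def[symmetric]
      using pos m elim by (simp add: field_simps)
  qed
qed

lemma min_moment_at_top:
  assumes lam: "0 < lam" "lam \<le> 1"
  shows "filterlim (min_moment lam) at_top sequentially"
proof (rule filterlim_at_top_mono)
  have "filterlim (\<lambda>n. exp (lam * ln (real n))) at_top sequentially"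
    by (intro filterlim_compose[OF exp_at_top] filterlim_tendsto_pos_mult_at_top[OF tendsto_const lam(1)]
        filterlim_compose[OF ln_at_top] filterlim_real_sequentially)
  hence "filterlim (\<lambda>n. real n powr lam) at_top sequentially"
    by (rule filterlim_at_top_mono) (auto simp: powr_def eventually_sequentially intro!: exI[of _ 1])
  thus "filterlim (\<lambda>n. (min_moment lam n / real n powr lam) * real n powr lam) at_top sequentially"
    by (rule filterlim_tendsto_pos_mult_at_top[OF min_moment_asymp[OF lam] Gamma_pos[OF lam]])
  show "eventually (\<lambda>n. (min_moment lam n / real n powr lam) * real n powr lam \<le> min_moment lam n) sequentially"
    using eventually_gt_at_top[of 0] by eventually_elim simp
qed

lemma upper_bound_limit:
  assumes lam: "0 < lam" "lam \<le> 1" and c: "0 < c"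
  shows "(\<lambda>n. min_moment lam n / ((c * min_moment lam n - 1)
      * (1 - exp (- (real n * (c * min_moment lam n) powr (- 1 / lam)))))) \<longlonglongrightarrow> 1 / g lam c"
proof (rule Lim_transform_eventually)
  let ?G = "min_moment lam"
  have pos: "0 < c * Gamma (2 - lam)" using lam c by (auto intro!: mult_pos_pos Gamma_real_pos)
  have inv: "(\<lambda>n. inverse (?G n)) \<longlonglongrightarrow> 0"
    by (rule tendsto_inverse_0_at_top[OF min_moment_at_top[OF lam]])
  \<comment> \<open>Dividing through by \<open>min_moment\<close> turns s - 1 into c minus a
    vanishing term, and the factor n moves inside the power as n^(-lam).\<close>
  have "(\<lambda>n. 1 / ((c - inverse (?G n)) * (1 - exp (- ((c * (?G n / real n powr lam)) powr (- 1 / lam))))))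
      \<longlonglongrightarrow> 1 / ((c - 0) * (1 - exp (- ((c * Gamma (2 - lam)) powr (- 1 / lam)))))"
    using pos c by (intro tendsto_intros inv min_moment_asymp lam) auto
  thus "(\<lambda>n. 1 / ((c - inverse (?G n)) * (1 - exp (- ((c * (?G n / real n powr lam)) powr (- 1 / lam))))))
      \<longlonglongrightarrow> 1 / g lam c" using c by (simp add: g_def)
  show "eventually (\<lambda>n. 1 / ((c - inverse (?G n)) * (1 - exp (- ((c * (?G n / real n powr lam)) powr (- 1 / lam)))))
      = ?G n / ((c * ?G n - 1) * (1 - exp (- (real n * (c * ?G n) powr (- 1 / lam)))))) sequentially"
    using eventually_gt_at_top[of 0]
  proof eventually_elim
    case (elim n)
    have G: "0 < ?G n" using min_moment_pos[OF lam] elim by simp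
    have "(c * (?G n / real n powr lam)) powr (- 1 / lam) = (c * ?G n) powr (- 1 / lam) / (real n powr lam) powr (- 1 / lam)"
      using G c by (simp add: powr_divide)
    also have "(real n powr lam) powr (- 1 / lam) = inverse (real n)"
      using lam elim by (simp add: powr_powr powr_minus)
    finally have 1: "(c * (?G n / real n powr lam)) powr (- 1 / lam) = real n * (c * ?G n) powr (- 1 / lam)"
      by (simp add: field_simps)
    have 2: "c - inverse (?G n) = (c * ?G n - 1) / ?G n" using G by (simp add: field_simps)
    show ?case unfolding 1 2 by simp
  qed
qed

lemma APX_limit:
  assumes lam: "0 < lam" "lam \<le> 1"
  shows "(\<lambda>n. APX n lam) \<longlonglongrightarrow> ereal (1 / (SUP c\<in>{0..1}. g lam c))"
proof -
  let ?K = "1 / (SUP c\<in>{0..1}. g lam c)" and ?G = "min_moment lam"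
  obtain a b where ab: "0 < a" "0 \<le> b" "\<forall>t>0. (a * t powr (- lam) + b) * (1 - exp (- t)) \<le> 1"
    "a * Gamma (2 - lam) + b = ?K"
    by (rule exists_line[OF lam])
  obtain c where c: "0 < c" "c \<le> 1" "g lam c = (SUP c\<in>{0..1}. g lam c)"
    using g_attained[OF lam] SUP_g[OF lam] by metis
  let ?l = "\<lambda>n. (a * (?G n / real n powr lam) + b) / (1 + 6 / real n)"
  let ?u = "\<lambda>n. ?G n / ((c * ?G n - 1) * (1 - exp (- (real n * (c * ?G n) powr (- 1 / lam)))))"
  show ?thesis
  proof (rule tendsto_sandwich)
    show "eventually (\<lambda>n. ereal (?l n) \<le> APX n lam) sequentially"
      using eventually_ge_at_top[of 2]
      by eventually_elim (intro APX_ge lam ab(1,2) ab(3)[rule_format])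
    \<comment> \<open>The choice s = c times \<open>min_moment\<close> eventually exceeds 1, and it
      is at most \<open>min_moment\<close> because c <= 1.\<close>
    have "eventually (\<lambda>n. 1 / c < ?G n) sequentially"
      using min_moment_at_top[OF lam] by (simp add: filterlim_at_top_dense)
    with eventually_gt_at_top[of 0]
    show "eventually (\<lambda>n. APX n lam \<le> ereal (?u n)) sequentially"
    proof eventually_elim
      case (elim n)
      have "1 < c * ?G n" using elim c by (simp add: field_simps)
      moreover have "c * ?G n \<le> ?G n"
        using c min_moment_pos[OF lam] elim by (simp add: mult_le_cancel_right1)
      ultimately show ?case using APX_le[OF lam, of n "c * ?G n"] elim by blast
    qed
    have "?l \<longlonglongrightarrow> (a * Gamma (2 - lam) + b) / (1 + 0)"
      by (intro tendsto_intros min_moment_asymp lam lim_const_over_n) simp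
    thus "(\<lambda>n. ereal (?l n)) \<longlonglongrightarrow> ereal ?K" unfolding ab(4) by simp
    show "(\<lambda>n. ereal (?u n)) \<longlonglongrightarrow> ereal ?K"
      using upper_bound_limit[OF lam c(1)] unfolding c(3) by simp
  qed
qed

theorem theorem5p5:
  shows "(\<exists>!l. is_lambda_star l) \<and> \<bar>lambda_star - 0.4940\<bar> < 0.00005 \<and>
    (\<forall>lam::real. 0 < lam \<and> lam < 1 \<longrightarrow> (\<exists>!x. is_eta lam x)) \<and>
    (\<forall>lam::real. 0 < lam \<and> lam \<le> 1 \<longrightarrow>
       ((\<lambda>n. APX n lam) \<longlonglongrightarrow> ereal (1 / (SUP c\<in>{0..1}. g lam c))) \<and>
       (lam \<le> lambda_star \<longrightarrow>
          1 / (SUP c\<in>{0..1}. g lam c)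
            = Gamma (2 - lam) * (lam + eta lam) / eta lam powr (1 - lam)) \<and>
       (lambda_star \<le> lam \<longrightarrow>
          1 / (SUP c\<in>{0..1}. g lam c)
            = 1 / (1 - exp (- (Gamma (2 - lam) powr (- 1 / lam))))))"
  using is_lambda_star_ex1 lambda_star_approx is_eta_ex1 APX_limit
    inverse_SUP_g_small inverse_SUP_g_large by blast

end
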